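(* Let $p$ be an odd prime. (i) We have $$\sum_{k=0}^{p-1}\frac{k^3\binom{2k}{k}^3}{64^k}\equiv\begin{cases}0\pmod p&\text{if }p\equiv1\pmod 4,\\ -\frac1{640}\left(\frac{p+1}4!\right)^{-4}\pmod p&\text{if }p\equiv3\pmod 4.\end{cases}$$ If $p>3$ and $p\equiv3\pmod4$, then $$\sum_{k=0}^{p-1}\binom{p-1}{k}\frac{\binom{2k}{k}^3}{(-64)^k}\equiv0\pmod{p^2}.$$ (ii) We have $$\sum_{k=0}^{p-1}\frac{C_k^2}{16^k}\equiv-3\pmod p,$$ and $$\sum_{k=0}^{p-1}\frac{C_k^3}{64^k}\equiv\begin{cases}7\pmod p&\text{if }p\equiv1\pmod4,\\ 7-\frac32\left(\frac{p+1}4!\right)^{-4}\pmod p&\text{if }p\equiv3\pmod4.\end{cases}$$ Also, $$\sum_{k=0}^{p-1}\frac{\binom{2k}{k}C_k}{32^k}\equiv\begin{cases}p\pmod{p^2}&\text{if }p\equiv1\pmod4,\\ {}p+(4p+2^p-6)\binom{(p-3)/2}{(p-3)/4}\pmod{p^2}&\text{if }p\equiv3\pmod4.\end{cases}$$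
   Context: Congruences modulo $p^m$ are between rational numbers whose denominators are prime to $p$: $a\equiv b\pmod{p^m}$ means that $a-b$ is $p^m$ times a rational number with denominator prime to $p$. $C_k=\frac1{k+1}\binom{2k}{k}$ ($k=0,1,2,\ldots$) are the Catalan numbers. The expression $\frac{p+1}4!$ means the factorial of the integer $(p+1)/4$ (when $p\equiv3\pmod4$). *)

theory Defs
  imports Complex_Main "HOL-Computational_Algebra.Primes"
begin

(* quotient_of yields the reduced fraction with positive denominator. *)
definition rat_cong :: "nat \<Rightarrow> nat \<Rightarrow> rat \<Rightarrow> rat \<Rightarrow> bool" where
  "rat_cong p m a b \<longleftrightarrow>
     (\<exists>c. coprime (snd (quotient_of c)) (int p) \<and> a - b = of_nat p ^ m * c)"

definition catalan :: "nat \<Rightarrow> rat" where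
  "catalan k = 1 / of_nat (k + 1) * of_nat ((2 * k) choose k)"

end

(*
  Write p = 2 n + 1. Modulo p the number binom(2k,k) / (-4)^k = binom(-1/2,k) is binom(n,k) for k <= n,
  while p divides binom(2k,k) for n < k < p and C_{p-1} = -1 modulo p. So the sums modulo p become sums
  of squares (Vandermonde) or alternating sums of cubes (Dixon) of the binomials binom(N,k) with
  N = n - 1 or N = n + 1; Wilson's theorem evaluates Dixon's product.

  For the sum modulo p^2 in (i), put y_k = binom(n+p,k), b_k = binom(n,k), h_k = binom(2k,k) / (-4)^k and
  w_k = (-1)^k binom(p-1,k). To first order in p, h_k, b_k and y_k are values of one linear function
  at 0, 1 and 3, so 2 h_k^3 = 3 b_k^3 - y_k^3 modulo p^2; moreover y_{n-k} = y_n b_k w_k modulo p^2. Dixon's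
  identity for the exponents n and n + p makes the alternating sums of b_k^3 and y_k^3 vanish
  modulo p^2, and these relations carry this over to w_k h_k^3 (dividing by 3, hence p > 3).

  For the last sum, h_k^2 = (-1)^k binom(n,k) binom(n+k,k) modulo p^2, which turns it into the integral of
  the Legendre polynomial P_n over [0,1]; this satisfies a two-term recurrence in n.
*)
theory Submission
  imports Defs "HOL-Number_Theory.Number_Theory"
begin

section \<open>Binomial identities\<close>

text \<open>The weights decide the exponent in Dixon's identity: k binom(n,k) = n binom(n-1,k-1)
  lowers it to n - 1, and binom(n,k) / (k+1) = binom(n+1,k+1) / (n+1) raises it to n + 1. For p = 4m
  + 3 these are 2m and 2m + 2, and the constants come from m = -3/4 modulo p: 640 = 8 * 80 and 3/2 =
  8 * 3/16, where -1/80 and 3/16 are left over from Dixon's products and the factors 8 come from n =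
  -1/2 and n + 1 = 1/2. The obstacle modulo p^2 in (i) is that h_k^3 and the weight w_k both deviate
  at order p from the terms b_k^3 and 1 for which Dixon's sum vanishes exactly. The product of the
  two deviations is a multiple of p^2, so they can be treated one at a time. The single auxiliary
  upper index n + p handles both: y_k perturbs b_k in the upper index, while read backwards it is,
  up to a constant, b_k with the factor w_k.\<close>

lemma sum_choose_mult_choose_mult_choose:
  "(\<Sum>j\<le>x. (x choose j) * (y choose j) * ((z + j) choose (x + y))) = (z choose x) * (z choose y)"
proof -
  \<comment> \<open>Absorbing \<open>j choose i\<close> into \<open>y choose j\<close> leaves a
    plain Vandermonde convolution.\<close>
  have inner: "(\<Sum>j\<le>x. (x choose j) * (y choose j) * (j choose i)) = (y choose i) * ((x + y - i) choose (x - i))"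
    if "i \<le> x" for i
  proof (cases "i \<le> y")
    case True
    have "(\<Sum>j\<le>x. (x choose j) * (y choose j) * (j choose i)) = (\<Sum>j\<in>{i..x}. (x choose j) * (y choose j) * (j choose i))"
      by (rule sum.mono_neutral_right) auto
    also have "\<dots> = (\<Sum>j\<in>{i..x}. (y choose i) * ((y - i) choose (j - i)) * (x choose (x - j)))"
    proof (rule sum.cong)
      fix j assume "j \<in> {i..x}"
      then show "(x choose j) * (y choose j) * (j choose i) = (y choose i) * ((y - i) choose (j - i)) * (x choose (x - j))"
        using True choose_mult[of i j y] binomial_symmetric[of j x] by (cases "j \<le> y") (auto simp: binomial_eq_0)
    qed simp
    also have "\<dots> = (\<Sum>l\<le>x - i. (y choose i) * ((y - i) choose l) * (x choose (x - i - l)))"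
      by (rule sum.reindex_bij_witness[of _ "\<lambda>l. l + i" "\<lambda>j. j - i"]) (use that in auto)
    also have "\<dots> = (y choose i) * ((x + y - i) choose (x - i))"
      using vandermonde[of "y - i" x "x - i"] True
      by (simp add: sum_distrib_left mult.assoc add.commute flip: sum_distrib_left)
    finally show ?thesis .
  next
    case False
    then have "(x choose j) * (y choose j) * (j choose i) = 0" for j by (cases "j \<le> y") auto
    with False show ?thesis by (simp only:) simp
  qed
  have outer: "(z choose (x + y - i)) * ((y choose i) * ((x + y - i) choose (x - i)))
      = (z choose y) * ((y choose i) * ((z - y) choose (x - i)))" if "i \<le> x" for i
  proof (cases "i \<le> y")
    case True
    have "(z choose (x + y - i)) * ((x + y - i) choose y) = (z choose y) * ((z - y) choose (x - i))"
    proof (cases "x + y - i \<le> z")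
      case True
      with that show ?thesis using choose_mult[of y "x + y - i" z] by simp
    next
      case False
      with that \<open>i \<le> y\<close> show ?thesis by (cases "y \<le> z") (simp_all add: binomial_eq_0)
    qed
    then show ?thesis
      using binomial_symmetric[of y "x + y - i"] that by (simp add: mult_ac)
  qed simp
  \<comment> \<open>Vandermonde separates z from j in \<open>(z + j) choose (x + y)\<close>. After
    the exchange of sums, \<open>inner\<close> evaluates the sum over j, and \<open>outer\<close>
    shapes the rest into a second Vandermonde sum.\<close>
  have "(\<Sum>j\<le>x. (x choose j) * (y choose j) * ((z + j) choose (x + y)))
      = (\<Sum>j\<le>x. \<Sum>i\<le>x. (z choose (x + y - i)) * ((x choose j) * (y choose j) * (j choose i)))"
  proof (rule sum.cong)
    fix j assume "j \<in> {..x}"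
    have "((z + j) choose (x + y)) = (\<Sum>i\<le>x + y. (j choose i) * (z choose (x + y - i)))"
      by (simp add: vandermonde add.commute)
    also have "\<dots> = (\<Sum>i\<le>x. (j choose i) * (z choose (x + y - i)))"
      using \<open>j \<in> {..x}\<close> by (intro sum.mono_neutral_right) auto
    finally show "(x choose j) * (y choose j) * ((z + j) choose (x + y))
        = (\<Sum>i\<le>x. (z choose (x + y - i)) * ((x choose j) * (y choose j) * (j choose i)))"
      by (simp add: sum_distrib_left mult_ac)
  qed simp
  also have "\<dots> = (\<Sum>i\<le>x. (z choose (x + y - i)) * (\<Sum>j\<le>x. (x choose j) * (y choose j) * (j choose i)))"
    by (subst sum.swap) (simp add: sum_distrib_left)
  also have "\<dots> = (\<Sum>i\<le>x. (z choose y) * ((y choose i) * ((z - y) choose (x - i))))"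
    by (intro sum.cong refl) (simp add: inner outer)
  also have "\<dots> = (z choose x) * (z choose y)"
    using vandermonde[of y "z - y" x]
    by (cases "y \<le> z") (simp_all add: mult.commute flip: sum_distrib_left)
  finally show ?thesis .
qed

text \<open>The product is a multinomial coefficient with blocks j, k - j, j, N - k - j. Choosing
  the two blocks of size j first leaves \<open>(N - 2 * j) choose (k - j)\<close>, whose alternating
  sum over k is 0 unless N = 2j.\<close>

lemma alternating_sum_choose_mult:
  "(\<Sum>k\<le>N. (-1) ^ k * of_nat ((N choose k) * (k choose j) * ((N - k) choose j)))
    = (if N = 2 * j then (-1) ^ j * of_nat (N choose j) else (0 :: 'a :: comm_ring_1))"
proof (cases "2 * j \<le> N")
  case True
  have "(\<Sum>k\<le>N. (-1) ^ k * of_nat ((N choose k) * (k choose j) * ((N - k) choose j)))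
      = (\<Sum>k\<in>{j..N - j}. (-1) ^ k * (of_nat ((N choose k) * (k choose j) * ((N - k) choose j)) :: 'a))"
  proof (rule sum.mono_neutral_right)
    show "\<forall>k\<in>{..N} - {j..N - j}. (-1) ^ k * (of_nat ((N choose k) * (k choose j) * ((N - k) choose j)) :: 'a) = 0"
    proof
      fix k assume "k \<in> {..N} - {j..N - j}"
      then have "k < j \<or> N - k < j" by auto
      then show "(-1) ^ k * (of_nat ((N choose k) * (k choose j) * ((N - k) choose j)) :: 'a) = 0"
        by (auto simp: binomial_eq_0)
    qed
  qed auto
  also have "\<dots> = (\<Sum>k\<in>{j..N - j}. (-1) ^ k * of_nat ((N choose j) * ((N - j) choose j) * ((N - 2 * j) choose (k - j))))"
  proof (rule sum.cong)
    fix k assume k: "k \<in> {j..N - j}"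
    have "(N choose k) * (k choose j) = (N choose j) * ((N - j) choose (k - j))"
      using k by (intro choose_mult) auto
    moreover have "((N - j) choose (k - j)) = ((N - j) choose (N - k))"
    proof -
      have "N - j - (k - j) = N - k" "k - j \<le> N - j" using k by auto
      then show ?thesis using binomial_symmetric[of "k - j" "N - j"] by simp
    qed
    moreover have "((N - j) choose (N - k)) * ((N - k) choose j) = ((N - j) choose j) * ((N - 2 * j) choose (N - k - j))"
    proof -
      have "j \<le> N - k" "N - k \<le> N - j" "N - j - j = N - 2 * j" using k True by auto
      then show ?thesis using choose_mult[of j "N - k" "N - j"] by simp
    qed
    moreover have "((N - 2 * j) choose (N - k - j)) = ((N - 2 * j) choose (k - j))"
    proof -
      have "k - j \<le> N - 2 * j" "N - 2 * j - (k - j) = N - k - j" using k True by auto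
      then show ?thesis using binomial_symmetric[of "k - j" "N - 2 * j"] by simp
    qed
    ultimately have "(N choose k) * (k choose j) * ((N - k) choose j) = (N choose j) * ((N - j) choose j) * ((N - 2 * j) choose (k - j))"
      by (metis mult.assoc)
    then show "(-1) ^ k * (of_nat ((N choose k) * (k choose j) * ((N - k) choose j)) :: 'a)
        = (-1) ^ k * of_nat ((N choose j) * ((N - j) choose j) * ((N - 2 * j) choose (k - j)))"
      by simp
  qed simp
  also have "\<dots> = (\<Sum>l\<le>N - 2 * j. (-1) ^ (l + j) * of_nat ((N choose j) * ((N - j) choose j) * ((N - 2 * j) choose l)))"
    by (rule sum.reindex_bij_witness[of _ "\<lambda>l. l + j" "\<lambda>k. k - j"]) (use True in auto)
  also have "\<dots> = (-1) ^ j * of_nat ((N choose j) * ((N - j) choose j)) * (\<Sum>l\<le>N - 2 * j. (-1) ^ l * of_nat ((N - 2 * j) choose l))"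
    by (simp add: sum_distrib_left power_add mult_ac)
  also have "\<dots> = (if N = 2 * j then (-1) ^ j * of_nat (N choose j) else 0)"
    using True choose_alternating_sum[of "N - 2 * j", where 'a = 'a] by (cases "N = 2 * j") auto
  finally show ?thesis .
next
  case False
  have "(-1) ^ k * (of_nat ((N choose k) * (k choose j) * ((N - k) choose j)) :: 'a) = 0" if "k \<le> N" for k
    using False that by (cases "k < j") (auto simp: binomial_eq_0)
  then have "(\<Sum>k\<le>N. (-1) ^ k * (of_nat ((N choose k) * (k choose j) * ((N - k) choose j)) :: 'a)) = 0"
    by (intro sum.neutral) blast
  with False show ?thesis by simp
qed

text \<open>The product formula with x = k, y = N - k, z = N expands the square of
  \<open>N choose k\<close>. The third factor then completes the summand of
  \<open>alternating_sum_choose_mult\<close>, so that j = N / 2 alone can contribute.\<close>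

lemma dixon_sum_eq:
  "(\<Sum>k\<le>N. (-1) ^ k * of_nat (N choose k) ^ 3)
    = (\<Sum>j\<le>N. of_nat ((N + j) choose N) * (if N = 2 * j then (-1) ^ j * of_nat (N choose j) else (0 :: 'a :: comm_ring_1)))"
proof -
  have cube: "(N choose k) ^ 3 = (\<Sum>j\<le>N. ((N + j) choose N) * ((N choose k) * (k choose j) * ((N - k) choose j)))"
    if "k \<le> N" for k
  proof -
    have "(N choose k) ^ 2 = (\<Sum>j\<le>k. (k choose j) * ((N - k) choose j) * ((N + j) choose N))"
      using sum_choose_mult_choose_mult_choose[of k "N - k" N] that binomial_symmetric[OF that]
      by (simp add: power2_eq_square)
    also have "\<dots> = (\<Sum>j\<le>N. (k choose j) * ((N - k) choose j) * ((N + j) choose N))"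
      using that by (intro sum.mono_neutral_left) auto
    finally show ?thesis
      by (simp add: power3_eq_cube power2_eq_square sum_distrib_left mult_ac)
  qed
  have "(\<Sum>k\<le>N. (-1) ^ k * (of_nat (N choose k) :: 'a) ^ 3)
      = (\<Sum>k\<le>N. \<Sum>j\<le>N. of_nat ((N + j) choose N) * ((-1) ^ k * of_nat ((N choose k) * (k choose j) * ((N - k) choose j))))"
    by (rule sum.cong) (simp_all add: cube sum_distrib_left mult_ac flip: of_nat_power)
  also have "\<dots> = (\<Sum>j\<le>N. of_nat ((N + j) choose N) * (\<Sum>k\<le>N. (-1) ^ k * of_nat ((N choose k) * (k choose j) * ((N - k) choose j))))"
    by (subst sum.swap) (simp add: sum_distrib_left)
  finally show ?thesis
    by (simp only: alternating_sum_choose_mult)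
qed

lemma dixon_odd:
  assumes "odd N"
  shows "(\<Sum>k\<le>N. (-1) ^ k * of_nat (N choose k) ^ 3) = (0 :: 'a :: comm_ring_1)"
  unfolding dixon_sum_eq using assms by (intro sum.neutral) auto

lemma dixon_even:
  "(\<Sum>k\<le>2 * a. (-1) ^ k * of_nat ((2 * a) choose k) ^ 3)
    = ((-1) ^ a * of_nat (((3 * a) choose a) * ((2 * a) choose a)) :: 'a :: comm_ring_1)"
proof -
  have "(\<Sum>j\<le>2 * a. of_nat ((2 * a + j) choose (2 * a)) * (if 2 * a = 2 * j then (-1) ^ j * of_nat ((2 * a) choose j) else (0 :: 'a)))
      = (\<Sum>j\<in>{a}. of_nat ((2 * a + j) choose (2 * a)) * (if 2 * a = 2 * j then (-1) ^ j * of_nat ((2 * a) choose j) else 0))"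
    by (rule sum.mono_neutral_right) auto
  then show ?thesis
    unfolding dixon_sum_eq using binomial_symmetric[of a "3 * a"] by (simp add: mult_ac)
qed

text \<open>The product in \<open>dixon_even\<close> is the multinomial coefficient (3a)! / (a!)^3;
  in this form, facts about factorials modulo p apply to it.\<close>

lemma choose_choose_mult_fact: "((3 * a) choose a) * ((2 * a) choose a) * fact a ^ 3 = (fact (3 * a) :: nat)"
proof -
  have "fact a * fact (2 * a) * ((3 * a) choose a) = (fact (3 * a) :: nat)"
    using binomial_fact_lemma[of a "3 * a"] by simp
  moreover have "fact a * fact a * ((2 * a) choose a) = (fact (2 * a) :: nat)"
    using binomial_fact_lemma[of a "2 * a"] by simp
  ultimately show ?thesis by (simp add: power3_eq_cube mult_ac) (metis mult.assoc mult.commute)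
qed

section \<open>Integrals of Legendre polynomials over [0,1]\<close>

text \<open>
  The value is the integral over \<open>[0, 1]\<close> of the Legendre polynomial
  \<open>\<Sum>k\<le>n. (n choose k) * ((n + k) choose k) * ((x - 1) / 2) ^ k\<close>, as that of \<open>((x - 1) / 2) ^ k\<close>
  is \<open>(-1/2) ^ k / (k + 1)\<close>.
\<close>

definition legendre_integral :: "nat \<Rightarrow> rat" where
  "legendre_integral n = (\<Sum>k\<le>n. of_nat ((n choose k) * ((n + k) choose k)) * (-1/2) ^ k / of_nat (k + 1))"

text \<open>\<open>h\<close> is the hypergeometric factor shared by the summands for n and n + 2,
  which reduces the recurrence to a polynomial identity. The linear factors vanish at k = n + 1 and
  k = n + 2, so the formula survives beyond the degree n.\<close>

lemma choose_mult_choose_eq: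
  assumes "k \<le> n + 2"
  defines "h \<equiv> of_nat (fact (n + k)) / (of_nat (fact (n + 2 - k)) * of_nat (fact k ^ 2)) :: rat"
  shows "of_nat ((n choose k) * ((n + k) choose k)) = (of_nat (n + 2) - of_nat k) * (of_nat (n + 1) - of_nat k) * h"
proof (cases "k \<le> n")
  case True
  then obtain d where d: "n = k + d" using le_Suc_ex by blast
  define u v :: rat where "u = of_nat d + 1" and "v = of_nat d + 2"
  have nz: "u \<noteq> 0" "v \<noteq> 0"
    unfolding u_def v_def by (metis of_nat_Suc of_nat_eq_0_iff add.commute nat.distinct(1) of_nat_numeral of_nat_add add_is_0 zero_neq_numeral)+
  have "(of_nat (fact (n + 2 - k)) :: rat) = v * (u * fact d)"
    unfolding d u_def v_def by (simp add: algebra_simps)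
  moreover have "(of_nat (n + 2) :: rat) - of_nat k = v" "(of_nat (n + 1) :: rat) - of_nat k = u"
    unfolding d u_def v_def by simp_all
  ultimately show ?thesis
    unfolding h_def of_nat_mult using d nz
    by (simp add: binomial_fact field_simps power2_eq_square)
next
  case False
  then have "k = n + 1 \<or> k = n + 2" using assms by auto
  then show ?thesis by auto
qed

text \<open>Analytically, (2n+1) P_n = P'_{n+1} - P'_{n-1} makes the integral P_{n-1}(0) / (n+1) for
  n > 0, and P_{n+1}(0) = -n/(n+1) P_{n-1}(0). The proof telescopes the finite sums instead.\<close>

lemma legendre_integral_rec: "of_nat (n + 3) * legendre_integral (n + 2) + of_nat n * legendre_integral n = 0"
proof -
  define h :: "nat \<Rightarrow> rat" where
    "h k = of_nat (fact (n + k)) / (of_nat (fact (n + 2 - k)) * of_nat (fact k ^ 2))" for k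
  define f :: "nat \<Rightarrow> nat \<Rightarrow> rat" where
    "f N k = of_nat ((N choose k) * ((N + k) choose k)) * (-1/2) ^ k / of_nat (k + 1)" for N k
  \<comment> \<open>\<open>g\<close> is the certificate produced by Zeilberger's algorithm.\<close>
  define g :: "nat \<Rightarrow> rat" where "g k = - (4 * of_nat n + 6) * of_nat k * h k * (-1/2) ^ k" for k
  have h_Suc: "of_nat (k + 1) ^ 2 * h (Suc k) = of_nat (n + k + 1) * (of_nat (n + 2) - of_nat k) * h k" if k: "k < n + 2" for k
  proof -
    obtain d where d: "n + 2 = k + Suc d" using less_imp_Suc_add[OF k] by (metis add_Suc_right)
    define u v :: rat where "u = of_nat d + 1" and "v = of_nat k + 1"
    have "of_nat (k + 1) = v" "of_nat (n + 2) - of_nat k = u"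
      using arg_cong[OF d, of "of_nat :: nat \<Rightarrow> rat"] by (simp_all add: u_def v_def)
    moreover have "u \<noteq> 0" "v \<noteq> 0"
      unfolding u_def v_def by (metis of_nat_Suc of_nat_eq_0_iff add.commute nat.distinct(1))+
    moreover have "h (Suc k) = of_nat (n + k + 1) * fact (n + k) / (fact d * (v * fact k) ^ 2)"
    proof -
      have e: "n + 2 - Suc k = d" "n + Suc k = Suc (n + k)" using d by auto
      show ?thesis unfolding h_def v_def e fact_Suc by (simp add: algebra_simps)
    qed
    moreover have "h k = fact (n + k) / (u * fact d * fact k ^ 2)"
    proof -
      have e: "n + 2 - k = Suc d" using d by auto
      show ?thesis unfolding h_def u_def e fact_Suc by (simp add: algebra_simps)
    qed
    ultimately show ?thesis
      by (simp add: power_mult_distrib power2_eq_square del: of_nat_add)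
  qed
  have f_n: "f n k = (of_nat (n + 2) - of_nat k) * (of_nat (n + 1) - of_nat k) * h k * (-1/2) ^ k / of_nat (k + 1)"
    and f_n2: "f (n + 2) k = of_nat (n + k + 1) * of_nat (n + k + 2) * h k * (-1/2) ^ k / of_nat (k + 1)"
    if k: "k \<le> n + 2" for k
  proof -
    show "f n k = (of_nat (n + 2) - of_nat k) * (of_nat (n + 1) - of_nat k) * h k * (-1/2) ^ k / of_nat (k + 1)"
      unfolding f_def h_def choose_mult_choose_eq[OF k] ..
    have "fact (n + 2 + k) = (of_nat (n + k + 1) * of_nat (n + k + 2) * fact (n + k) :: rat)"
      by (simp add: algebra_simps)
    then have "of_nat (((n + 2) choose k) * ((n + 2 + k) choose k)) = of_nat (n + k + 1) * of_nat (n + k + 2) * h k"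
      using k unfolding h_def of_nat_mult by (simp add: binomial_fact power2_eq_square mult_ac del: of_nat_add)
    then show "f (n + 2) k = of_nat (n + k + 1) * of_nat (n + k + 2) * h k * (-1/2) ^ k / of_nat (k + 1)"
      unfolding f_def by simp
  qed
  \<comment> \<open>The bound on K is essential: past k = n + 2 the subtraction in \<open>h\<close>
    is truncated and \<open>h\<close> no longer follows its ratio.\<close>
  have partial: "(\<Sum>k<K. of_nat (n + 3) * f (n + 2) k + of_nat n * f n k) = g K" if "K \<le> n + 2" for K
    using that
  proof (induction K)
    case 0
    then show ?case by (simp add: g_def)
  next
    case (Suc K)
    define q x P where "q = (of_nat K + 1 :: rat)" and "x = (of_nat n :: rat)" and "P = ((-1/2) ^ K :: rat)"
    have q: "q \<noteq> 0" unfolding q_def by (metis of_nat_Suc of_nat_eq_0_iff add.commute nat.distinct(1))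
    have sums: "of_nat K = q - 1" "of_nat (Suc K) = q" "of_nat (K + 1) = q" "of_nat (n + K + 1) = x + q"
      "of_nat (n + K + 2) = x + q + 1" "of_nat (n + 2) = x + 2" "of_nat (n + 1) = x + 1" "of_nat (n + 3) = x + 3" "of_nat n = x"
      by (simp_all add: q_def x_def)
    have hq: "h (Suc K) = (x + q) * (x + 3 - q) * h K / q ^ 2"
      using h_Suc[of K] Suc.prems q unfolding sums by (simp add: field_simps)
    \<comment> \<open>This is the telescoping step, \<open>g K\<close> plus the summand at K equals
      \<open>g (Suc K)\<close>, divided by \<open>h K * P / q\<close>.\<close>
    have poly: "- (4 * x + 6) * (q - 1) * q + ((x + 3) * ((x + q) * (x + q + 1)) + x * ((x + 2 - (q - 1)) * (x + 1 - (q - 1))))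
        = (2 * x + 3) * ((x + q) * (x + 3 - q))"
      by (simp add: algebra_simps)
    have "(\<Sum>k<Suc K. of_nat (n + 3) * f (n + 2) k + of_nat n * f n k)
        = - (4 * x + 6) * (q - 1) * h K * P
          + ((x + 3) * ((x + q) * (x + q + 1)) + x * ((x + 2 - (q - 1)) * (x + 1 - (q - 1)))) * h K * P / q"
    proof -
      have K: "K \<le> n + 2" using Suc.prems by simp
      have lin: "a * (U * h K * P / q) + b * (V * h K * P / q) = (a * U + b * V) * h K * P / q" for a b U V
        by (simp add: add_divide_distrib distrib_right mult.assoc)
      show ?thesis
        using Suc.IH[OF K] unfolding sum.lessThan_Suc f_n[OF K] f_n2[OF K] g_def sums P_def[symmetric] lin
        by (simp only:)
    qed
    also have "\<dots> = (- (4 * x + 6) * (q - 1) * q + ((x + 3) * ((x + q) * (x + q + 1)) + x * ((x + 2 - (q - 1)) * (x + 1 - (q - 1))))) * h K * P / q"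
      using q by (simp add: add_divide_distrib distrib_right)
    also have "\<dots> = g (Suc K)"
      using q unfolding poly g_def hq sums by (simp add: P_def power2_eq_square) (simp add: field_simps)
    finally show ?case .
  qed
  have f0: "f N k = 0" if "k > N" for N k
    using that by (simp add: f_def)
  have "legendre_integral (n + 2) = (\<Sum>k<n + 3. f (n + 2) k)"
    unfolding legendre_integral_def f_def by (rule sum.cong) auto
  moreover have "legendre_integral n = (\<Sum>k<n + 3. f n k)"
    unfolding legendre_integral_def f_def[symmetric]
    by (rule sum.mono_neutral_left) (auto simp: f0)
  ultimately have "of_nat (n + 3) * legendre_integral (n + 2) + of_nat n * legendre_integral n
      = (\<Sum>k<n + 3. of_nat (n + 3) * f (n + 2) k + of_nat n * f n k)"
    by (simp add: sum_distrib_left sum.distrib)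
  \<comment> \<open>The term k = n + 2 lies outside the telescoped range. Its \<open>f n\<close>
    part is 0, and the rest cancels \<open>g (n + 2)\<close>.\<close>
  also have "\<dots> = g (n + 2) + (of_nat (n + 3) * f (n + 2) (n + 2) + of_nat n * f n (n + 2))"
    using partial[of "n + 2"] by (simp add: eval_nat_numeral)
  also have "\<dots> = 0"
  proof -
    have "(of_nat (n + 2 + 1) :: rat) \<noteq> 0" by (simp del: of_nat_add)
    then show ?thesis by (simp only: f_n[OF order_refl] f_n2[OF order_refl] g_def) (simp add: field_simps)
  qed
  finally show ?thesis .
qed

text \<open>At n = 0 the factor \<open>of_nat n\<close> removes the nonzero
  \<open>legendre_integral 0\<close>, so the chain starts with 0 at index 2. Analytically, the
  integral is half of that over [-1,1], where P_n is orthogonal to 1.\<close>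

lemma legendre_integral_even:
  assumes "even n" "n > 0"
  shows "legendre_integral n = 0"
proof -
  have "legendre_integral (2 * i + 2) = 0" for i
  proof (induction i)
    case 0
    then show ?case using legendre_integral_rec[of 0] by simp
  next
    case (Suc i)
    have "(of_nat (2 * i + 2 + 3) :: rat) * legendre_integral (2 * i + 2 + 2) = 0"
      using legendre_integral_rec[of "2 * i + 2"] Suc by simp
    moreover have "(of_nat (2 * i + 2 + 3) :: rat) \<noteq> 0" by (metis of_nat_eq_0_iff add_is_0 zero_neq_numeral)
    ultimately show ?case by simp
  qed
  moreover obtain i where "n = 2 * i + 2"
    using assms by (metis evenE add_2_eq_Suc' gr0_conv_Suc mult_Suc_right mult_0_right add.commute not0_implies_Suc)
  ultimately show ?thesis by simp
qed

lemma central_choose_Suc: "Suc m * ((2 * Suc m) choose Suc m) = 2 * (2 * m + 1) * ((2 * m) choose m)"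
proof -
  have "Suc m * ((2 * Suc m) choose Suc m) = (2 * Suc m) * ((2 * m + 1) choose m)"
    using Suc_times_binomial[of m "2 * m + 1"] by simp
  moreover have "Suc m * ((2 * m + 1) choose m) = (2 * m + 1) * ((2 * m) choose m)"
    using Suc_times_binomial[of m "2 * m"] binomial_symmetric[of m "2 * m + 1"] by (simp add: mult_2)
  ultimately show ?thesis by (metis mult.assoc)
qed

text \<open>The value is P_{2m}(0) / (2m + 2).\<close>

lemma legendre_integral_odd:
  "legendre_integral (2 * m + 1) = (-1) ^ m * of_nat ((2 * m) choose m) / (2 * of_nat (m + 1) * 4 ^ m)"
proof (induction m)
  case 0
  then show ?case by (simp add: legendre_integral_def)
next
  case (Suc m)
  have "Suc m * ((2 * Suc m) choose Suc m) = 2 * (2 * m + 1) * ((2 * m) choose m)"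
    by (rule central_choose_Suc)
  then have r: "of_nat ((2 * Suc m) choose Suc m) = 2 * of_nat (2 * m + 1) * of_nat ((2 * m) choose m) / (of_nat (m + 1) :: rat)"
  proof -
    have "of_nat (Suc m) * (of_nat ((2 * Suc m) choose Suc m) :: rat) = 2 * of_nat (2 * m + 1) * of_nat ((2 * m) choose m)"
      using arg_cong[OF \<open>Suc m * _ = _\<close>, of "of_nat :: nat \<Rightarrow> rat"] by (simp only: of_nat_mult of_nat_numeral)
    then show ?thesis by (simp add: field_simps del: binomial_Suc_Suc)
  qed
  have nz: "(of_nat (m + 1) :: rat) \<noteq> 0" "(of_nat (m + 2) :: rat) \<noteq> 0"
    by (simp_all del: of_nat_add)
  have "of_nat (2 * m + 4) * legendre_integral (2 * m + 3) = - of_nat (2 * m + 1) * legendre_integral (2 * m + 1)"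
  proof -
    have "2 * m + 1 + 3 = 2 * m + 4" "2 * m + 1 + 2 = 2 * m + 3" by simp_all
    with legendre_integral_rec[of "2 * m + 1"]
    have "of_nat (2 * m + 4) * legendre_integral (2 * m + 3) + of_nat (2 * m + 1) * legendre_integral (2 * m + 1) = 0"
      by metis
    then show ?thesis by (simp only: add_eq_0_iff2 minus_mult_left)
  qed
  moreover have "(of_nat (2 * m + 4) :: rat) = 2 * of_nat (m + 2)" by simp
  ultimately have "legendre_integral (2 * m + 3) = - of_nat (2 * m + 1) * legendre_integral (2 * m + 1) / (2 * of_nat (m + 2))"
    using nz by (metis mult_eq_0_iff nonzero_mult_div_cancel_left zero_neq_numeral)
  also have "\<dots> = (-1) ^ Suc m * of_nat ((2 * Suc m) choose Suc m) / (2 * of_nat (Suc m + 1) * 4 ^ Suc m)"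
    unfolding Suc.IH r using nz by (simp add: field_simps del: of_nat_add of_nat_Suc)
  finally show ?case by (simp add: eval_nat_numeral)
qed

section \<open>Congruences in the localization of the integers at p\<close>

definition p_integral :: "nat \<Rightarrow> rat \<Rightarrow> bool" where
  "p_integral p x \<longleftrightarrow> coprime (snd (quotient_of x)) (int p)"

text \<open>The reduced denominator divides every other one, so any fraction with denominator prime
  to p is a witness; the closure rules depend on this.\<close>

lemma p_integral_iff: "p_integral p x \<longleftrightarrow> (\<exists>a b. coprime b (int p) \<and> b \<noteq> 0 \<and> x = of_int a / of_int b)"
proof
  assume "p_integral p x"
  then show "\<exists>a b. coprime b (int p) \<and> b \<noteq> 0 \<and> x = of_int a / of_int b"
    unfolding p_integral_def
    by (metis prod.collapse quotient_of_div quotient_of_denom_pos' less_irrefl)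
next
  assume "\<exists>a b. coprime b (int p) \<and> b \<noteq> 0 \<and> x = of_int a / of_int b"
  then obtain a b where ab: "coprime b (int p)" "b \<noteq> 0" "x = of_int a / of_int b" by blast
  obtain n d where nd: "quotient_of x = (n, d)" by fastforce
  have "x = of_int n / of_int d" "d > 0" "coprime n d"
    using nd quotient_of_div quotient_of_denom_pos quotient_of_coprime by blast+
  then have "(of_int (n * b) :: rat) = of_int (a * d)"
    using ab by (simp add: field_simps)
  then have "n * b = a * d" by (simp only: of_int_eq_iff)
  then have "d dvd b" using \<open>coprime n d\<close>
    by (metis coprime_commute coprime_dvd_mult_right_iff dvd_triv_right)
  then show "p_integral p x"
    unfolding p_integral_def nd using ab(1) by (simp add: coprime_divisors[OF _ dvd_refl])
qed

lemma p_integral_of_int [simp]: "p_integral p (of_int a)"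
  unfolding p_integral_iff by (metis coprime_1_left div_by_1 of_int_1 zero_neq_one)

lemma p_integral_of_nat [simp]: "p_integral p (of_nat a)"
  using p_integral_of_int[of p "int a"] by simp

lemma p_integral_numeral [simp]: "p_integral p (numeral a)"
  using p_integral_of_int[of p "numeral a"] by simp

lemma p_integral_0 [simp]: "p_integral p 0" and p_integral_1 [simp]: "p_integral p 1"
  using p_integral_of_int[of p 0] p_integral_of_int[of p 1] by simp_all

lemma p_integral_fact [simp]: "p_integral p (fact a)"
  using p_integral_of_nat[of p "fact a"] by simp

lemma p_integral_mult [simp]:
  assumes "p_integral p x" "p_integral p y" shows "p_integral p (x * y)"
proof -
  obtain a b c d where *: "coprime b (int p)" "b \<noteq> 0" "x = of_int a / of_int b" "coprime d (int p)" "d \<noteq> 0" "y = of_int c / of_int d"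
    using assms unfolding p_integral_iff by metis
  then have "coprime (b * d) (int p)" "b * d \<noteq> 0" "x * y = of_int (a * c) / of_int (b * d)"
    by auto
  then show ?thesis unfolding p_integral_iff by blast
qed

lemma p_integral_add [simp]:
  assumes "p_integral p x" "p_integral p y" shows "p_integral p (x + y)"
proof -
  obtain a b c d where *: "coprime b (int p)" "b \<noteq> 0" "x = of_int a / of_int b" "coprime d (int p)" "d \<noteq> 0" "y = of_int c / of_int d"
    using assms unfolding p_integral_iff by metis
  then have "coprime (b * d) (int p)" "b * d \<noteq> 0" "x + y = of_int (a * d + b * c) / of_int (b * d)"
    by (auto simp: field_simps)
  then show ?thesis unfolding p_integral_iff by blast
qed

lemma p_integral_minus [simp]: "p_integral p (- x) \<longleftrightarrow> p_integral p x"
  using p_integral_mult[of p "-1" x] p_integral_mult[of p "-1" "-x"] p_integral_of_int[of p "-1"] by auto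

lemma p_integral_diff [simp]:
  assumes "p_integral p x" "p_integral p y" shows "p_integral p (x - y)"
  using p_integral_add[of p x "- y"] assms by simp

lemma p_integral_power [simp]: "p_integral p x \<Longrightarrow> p_integral p (x ^ k)"
  by (induction k) auto

lemma p_integral_sum: "(\<And>i. i \<in> A \<Longrightarrow> p_integral p (f i)) \<Longrightarrow> p_integral p (sum f A)"
  by (induction A rule: infinite_finite_induct) auto

lemma p_integral_inverse_of_int: "coprime a (int p) \<Longrightarrow> a \<noteq> 0 \<Longrightarrow> p_integral p (1 / of_int a)"
  unfolding p_integral_iff by (metis of_int_1)

lemma p_integral_inverse_of_nat: "coprime a p \<Longrightarrow> a \<noteq> 0 \<Longrightarrow> p_integral p (1 / of_nat a)"
  using p_integral_inverse_of_int[of "int a" p] by simp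

section \<open>Calculus of congruences between rationals\<close>

lemma rat_cong_iff: "rat_cong p m a b \<longleftrightarrow> (\<exists>c. p_integral p c \<and> a - b = of_nat p ^ m * c)"
  unfolding rat_cong_def p_integral_def ..

lemma rat_congI: "p_integral p c \<Longrightarrow> a - b = of_nat p ^ m * c \<Longrightarrow> rat_cong p m a b"
  unfolding rat_cong_iff by blast

lemma rat_cong_refl [simp, intro]: "rat_cong p m a a"
  by (rule rat_congI[of p 0]) auto

lemma rat_cong_add:
  assumes "rat_cong p m a b" "rat_cong p m c d" shows "rat_cong p m (a + c) (b + d)"
proof -
  obtain x y where "p_integral p x" "a - b = of_nat p ^ m * x" "p_integral p y" "c - d = of_nat p ^ m * y"
    using assms unfolding rat_cong_iff by blast
  then show ?thesis by (intro rat_congI[of p "x + y"]) (auto simp: algebra_simps)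
qed

lemma rat_cong_scale:
  assumes "rat_cong p m a b" "p_integral p c" shows "rat_cong p m (c * a) (c * b)"
proof -
  obtain x where "p_integral p x" "a - b = of_nat p ^ m * x"
    using assms unfolding rat_cong_iff by blast
  then show ?thesis using assms(2)
    by (intro rat_congI[of p "c * x"]) (auto simp: algebra_simps simp flip: right_diff_distrib)
qed

lemma rat_cong_minus: "rat_cong p m a b \<Longrightarrow> rat_cong p m (- a) (- b)"
  using rat_cong_scale[of p m a b "-1"] by simp

lemma rat_cong_sym: "rat_cong p m a b \<Longrightarrow> rat_cong p m b a"
  using rat_cong_add[OF rat_cong_minus rat_cong_refl, of p m a b "a + b"] by simp

lemma rat_cong_trans [trans]: "rat_cong p m a b \<Longrightarrow> rat_cong p m b c \<Longrightarrow> rat_cong p m a c"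
  using rat_cong_add[of p m a b b c] rat_cong_add[of p m "a + b" "b + c" "- b" "- b"] by simp

lemma rat_cong_diff:
  "rat_cong p m a b \<Longrightarrow> rat_cong p m c d \<Longrightarrow> rat_cong p m (a - c) (b - d)"
  using rat_cong_add[OF _ rat_cong_minus, of p m a b c d] by simp

text \<open>From a c - b d = c (a - b) + b (c - d): integrality is asked of \<open>b\<close> and
  \<open>c\<close>, one member of each congruence.\<close>

lemma rat_cong_mult:
  assumes "rat_cong p m a b" "rat_cong p m c d" "p_integral p b" "p_integral p c"
  shows "rat_cong p m (a * c) (b * d)"
  using rat_cong_trans[OF rat_cong_scale[OF assms(1,4)], of "b * d"] rat_cong_scale[OF assms(2,3)]
  by (simp add: mult.commute)

lemma rat_cong_integral: "rat_cong p m a b \<Longrightarrow> p_integral p b \<Longrightarrow> p_integral p a"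
  unfolding rat_cong_iff
  by (metis diff_add_cancel p_integral_add p_integral_mult p_integral_of_nat p_integral_power)

lemma rat_cong_power:
  assumes "rat_cong p m a b" "p_integral p b" shows "rat_cong p m (a ^ k) (b ^ k)"
proof (induction k)
  case (Suc k)
  show ?case using rat_cong_mult[OF assms(1) Suc assms(2)] rat_cong_integral[OF assms] by simp
qed simp

lemma rat_cong_sum:
  "(\<And>i. i \<in> A \<Longrightarrow> rat_cong p m (f i) (g i)) \<Longrightarrow> rat_cong p m (sum f A) (sum g A)"
  by (induction A rule: infinite_finite_induct) (auto intro: rat_cong_add)

lemma rat_cong_cancel:
  assumes "rat_cong p m (u * a) (u * b)" "p_integral p (1 / u)" "u \<noteq> 0"
  shows "rat_cong p m a b"
  using rat_cong_scale[OF assms(1,2)] assms(3) by simp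

lemma rat_cong_mod_power_le:
  assumes "rat_cong p m a b" "k \<le> m" shows "rat_cong p k a b"
proof -
  obtain x where "p_integral p x" "a - b = of_nat p ^ m * x"
    using assms unfolding rat_cong_iff by blast
  then show ?thesis using assms(2)
    by (intro rat_congI[of p "of_nat p ^ (m - k) * x"]) (auto simp: mult.assoc[symmetric] simp flip: power_add)
qed

lemma rat_cong_mult_zero:
  assumes "rat_cong p k a 0" "rat_cong p l b 0" shows "rat_cong p (k + l) (a * b) 0"
proof -
  obtain x y where "p_integral p x" "a = of_nat p ^ k * x" "p_integral p y" "b = of_nat p ^ l * y"
    using assms unfolding rat_cong_iff by auto
  then show ?thesis by (intro rat_congI[of p "x * y"]) (auto simp: power_add)
qed

lemma rat_cong_zero_iff_diff: "rat_cong p m (a - b) 0 \<longleftrightarrow> rat_cong p m a b"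
  unfolding rat_cong_iff by simp

lemma rat_cong_of_int:
  assumes "[a = b] (mod int p ^ m)" shows "rat_cong p m (of_int a) (of_int b)"
proof -
  obtain c where "a - b = int p ^ m * c" using assms by (metis cong_iff_dvd_diff dvdE)
  then have "(of_int (a - b) :: rat) = of_int (int p ^ m * c)" by (simp only:)
  then show ?thesis by (intro rat_congI[of p "of_int c"]) auto
qed

lemma rat_cong_of_nat_dvd: "p ^ m dvd a \<Longrightarrow> rat_cong p m (of_nat a) 0"
  using rat_cong_of_int[of "int a" 0 p m] by (simp add: cong_0_iff flip: of_nat_power)

text \<open>Induction step for comparing two hypergeometric sequences: X'/X = r/s and Y'/Y = r'/s
  with congruent numerators and a common denominator that is a unit.\<close>

lemma rat_cong_step:
  assumes "rat_cong p m X Y" "s * X' = r * X" "s * Y' = r' * Y" "rat_cong p m r r'"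
    "p_integral p (1 / s)" "s \<noteq> 0" "p_integral p Y" "p_integral p r"
  shows "rat_cong p m X' Y'"
proof (rule rat_cong_cancel)
  show "rat_cong p m (s * X') (s * Y')"
    unfolding assms(2,3) using rat_cong_mult[OF assms(1,4,7,8)] by (simp add: mult.commute)
qed (use assms in auto)

section \<open>Binomial coefficients modulo powers of p\<close>

text \<open>Over the rationals the difference is not truncated, so the recursion also holds for k
  beyond N.\<close>

lemma of_nat_choose_Suc:
  "of_nat (Suc k) * of_nat (N choose Suc k) = ((of_nat N - of_nat k) * of_nat (N choose k) :: rat)"
  using gbinomial_mult_1[of "of_nat N :: rat" k] by (simp add: binomial_gbinomial algebra_simps)

definition half_choose :: "nat \<Rightarrow> rat" where
  "half_choose k = of_nat ((2 * k) choose k) / (-4) ^ k"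

lemma half_choose_Suc: "of_nat (2 * (k + 1)) * half_choose (Suc k) = - of_nat (2 * k + 1) * half_choose k"
proof -
  have "of_nat (Suc k) * (of_nat ((2 * Suc k) choose Suc k) :: rat) = 2 * of_nat (2 * k + 1) * of_nat ((2 * k) choose k)"
    using arg_cong[OF central_choose_Suc, of "of_nat :: nat \<Rightarrow> rat"] by (simp only: of_nat_mult of_nat_numeral)
  moreover have "(2 * q) * (x / (-4 * e)) = - (q * x) / (2 * e)" if "e \<noteq> 0" for q x e :: rat
    using that by (simp add: field_simps)
  from this[of "(-4) ^ k" "of_nat (Suc k)"]
  have "of_nat (2 * (k + 1)) * half_choose (Suc k) = - (of_nat (Suc k) * of_nat ((2 * Suc k) choose Suc k)) / (2 * (-4) ^ k)"
    unfolding half_choose_def power_Suc of_nat_mult by simp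
  ultimately have "of_nat (2 * (k + 1)) * half_choose (Suc k) = - (2 * of_nat (2 * k + 1) * of_nat ((2 * k) choose k)) / (2 * (-4) ^ k)"
    by (simp only:)
  moreover have "- (2 * a * b) / (2 * c) = - a * (b / c)" for a b c :: rat
    by simp
  ultimately show ?thesis unfolding half_choose_def by metis
qed

lemma half_choose_0 [simp]: "half_choose 0 = 1" by (simp add: half_choose_def)

lemma half_choose_sq: "half_choose k ^ 2 = of_nat ((2 * k) choose k) ^ 2 / 16 ^ k"
proof -
  have "((-4) ^ k) ^ 2 = (16 ^ k :: rat)"
    by (simp add: power2_eq_square flip: power_mult_distrib)
  then show ?thesis by (simp only: half_choose_def power_divide)
qed

lemma half_choose_cube: "half_choose k ^ 3 = (-1) ^ k * of_nat ((2 * k) choose k) ^ 3 / 64 ^ k"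
proof -
  have "((-4) ^ k) ^ 3 = ((-1) ^ k * 64 ^ k :: rat)"
    by (simp add: power_mult[symmetric] mult.commute[of k] flip: power_mult_distrib) (simp add: power_mult)
  then show ?thesis by (simp add: half_choose_def power_divide field_simps)
qed

context
  fixes p n :: nat
  assumes p: "prime p" and pn: "p = 2 * n + 1"
begin

lemma n_pos: "n \<ge> 1"
  using p pn by (cases n) auto

lemma of_nat_p: "(of_nat p :: rat) = 2 * of_nat n + 1"
  using pn by simp

lemma p_integral_inverse: "0 < k \<Longrightarrow> k < p \<Longrightarrow> p_integral p (1 / of_nat k)"
  using p prime_imp_coprime[of p k] nat_dvd_not_less[of k p]
  by (intro p_integral_inverse_of_nat) (auto simp: coprime_commute)

lemma p_integral_inverse_2: "p_integral p (1 / 2)"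
  using p_integral_inverse[of 2] n_pos pn by simp

lemma p_integral_inverse_mult: "p_integral p (1 / x) \<Longrightarrow> p_integral p (1 / y) \<Longrightarrow> p_integral p (1 / (x * y))"
  using p_integral_mult[of p "1 / x" "1 / y"] by simp

lemma p_integral_inverse_power: "p_integral p (1 / x) \<Longrightarrow> p_integral p (1 / x ^ k)"
  using p_integral_power[of p "1 / x" k] by (simp add: power_divide)

lemma p_integral_divide: "p_integral p a \<Longrightarrow> p_integral p (1 / b) \<Longrightarrow> p_integral p (a / b)"
  using p_integral_mult[of p a "1 / b"] by simp

lemma p_integral_half_choose: "p_integral p (half_choose k)"
proof -
  have "p_integral p (1 / (-4) ^ k)"
    using p_integral_inverse_2 p_integral_inverse_mult[of 2 2]
    by (intro p_integral_inverse_power) simp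
  then show ?thesis unfolding half_choose_def by (rule p_integral_divide[rotated]) simp
qed

text \<open>Twice n - k is p - (2k + 1), so the ratios of consecutive terms agree modulo p. Their
  denominators 2(k + 1) are at most 2n = p - 1, hence invertible.\<close>

lemma half_choose_cong: "k \<le> n \<Longrightarrow> rat_cong p 1 (of_nat (n choose k)) (half_choose k)"
proof (induction k)
  case (Suc k)
  show ?case
  proof (rule rat_cong_step)
    show "rat_cong p 1 (of_nat (n choose k)) (half_choose k)" using Suc by simp
    show "of_nat (2 * (k + 1)) * of_nat (n choose Suc k) = (of_nat p - of_nat (2 * k + 1)) * (of_nat (n choose k) :: rat)"
      using of_nat_choose_Suc[of k n] by (simp add: of_nat_p algebra_simps)
    show "rat_cong p 1 (of_nat p - of_nat (2 * k + 1)) (- of_nat (2 * k + 1))"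
      by (rule rat_congI[of p 1]) auto
    show "p_integral p (1 / of_nat (2 * (k + 1)))"
      by (rule p_integral_inverse) (use Suc.prems pn in auto)
  qed (use half_choose_Suc[of k] in \<open>simp_all add: p_integral_half_choose del: of_nat_add of_nat_mult\<close>)
qed simp

text \<open>One order better than \<open>half_choose_cong\<close>, because n and -n - 1 are
  symmetric about -1/2: 4 (n - k) (n + k + 1) = p^2 - (2k + 1)^2 has no term linear in p.\<close>

lemma half_choose_sq_cong:
  "k \<le> n \<Longrightarrow> rat_cong p 2 ((-1) ^ k * of_nat ((n choose k) * ((n + k) choose k))) (half_choose k ^ 2)"
proof (induction k)
  case (Suc k)
  show ?case
  proof (rule rat_cong_step)
    show "rat_cong p 2 ((-1) ^ k * of_nat ((n choose k) * ((n + k) choose k))) (half_choose k ^ 2)" using Suc by simp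
    have "of_nat (Suc k) * of_nat ((n + Suc k) choose Suc k) = (of_nat (n + k + 1) * of_nat ((n + k) choose k) :: rat)"
      using arg_cong[OF Suc_times_binomial[of k "n + k"], of "of_nat :: nat \<Rightarrow> rat"] by (simp only: of_nat_mult add_Suc_right Suc_eq_plus1 add.assoc)
    moreover have "of_nat (2 * (k + 1)) = (2 * of_nat (Suc k) :: rat)" by simp
    moreover have "(2 * q) ^ 2 * ((-1) ^ Suc k * (x * y)) = - (4 * (-1) ^ k) * (q * x) * (q * y)" for q x y :: rat
      by (simp add: power2_eq_square mult_ac)
    ultimately have "of_nat (2 * (k + 1)) ^ 2 * ((-1) ^ Suc k * of_nat ((n choose Suc k) * ((n + Suc k) choose Suc k)))
        = - (4 * (-1) ^ k) * (of_nat (Suc k) * of_nat (n choose Suc k)) * (of_nat (n + k + 1) * of_nat ((n + k) choose k) :: rat)"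
      by (metis of_nat_mult)
    also have "\<dots> = (of_nat (2 * k + 1) ^ 2 - of_nat p ^ 2) * ((-1) ^ k * of_nat ((n choose k) * ((n + k) choose k)))"
      unfolding of_nat_choose_Suc by (simp add: of_nat_p power2_eq_square) (simp add: algebra_simps)
    finally show "of_nat (2 * (k + 1)) ^ 2 * ((-1) ^ Suc k * of_nat ((n choose Suc k) * ((n + Suc k) choose Suc k)))
        = (of_nat (2 * k + 1) ^ 2 - of_nat p ^ 2 :: rat) * ((-1) ^ k * of_nat ((n choose k) * ((n + k) choose k)))" .
    show "of_nat (2 * (k + 1)) ^ 2 * half_choose (Suc k) ^ 2 = of_nat (2 * k + 1) ^ 2 * half_choose k ^ 2"
      unfolding power_mult_distrib[symmetric] half_choose_Suc by (simp only: mult_minus_left power2_minus)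
    show "rat_cong p 2 (of_nat (2 * k + 1) ^ 2 - of_nat p ^ 2) (of_nat (2 * k + 1) ^ 2)"
      by (rule rat_congI[of p "-1"]) auto
    show "p_integral p (1 / of_nat (2 * (k + 1)) ^ 2)"
      by (intro p_integral_inverse_power p_integral_inverse) (use Suc.prems pn in auto)
  qed (simp_all add: p_integral_half_choose)
qed simp

lemma choose_add_p_cong: "k < p \<Longrightarrow> rat_cong p 1 (of_nat ((p + k) choose k)) 1"
proof (induction k)
  case (Suc k)
  show ?case
  proof (rule rat_cong_step)
    show "rat_cong p 1 (of_nat ((p + k) choose k)) 1" using Suc by simp
    show "of_nat (k + 1) * of_nat ((p + Suc k) choose Suc k) = (of_nat p + of_nat (k + 1)) * (of_nat ((p + k) choose k) :: rat)"
      using arg_cong[OF Suc_times_binomial[of k "p + k"], of "of_nat :: nat \<Rightarrow> rat"]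
      by (simp only: of_nat_mult add_Suc_right Suc_eq_plus1 of_nat_add add.assoc)
    show "rat_cong p 1 (of_nat p + of_nat (k + 1)) (of_nat (k + 1))"
      by (rule rat_congI[of p 1]) auto
    show "p_integral p (1 / of_nat (k + 1))"
      by (rule p_integral_inverse) (use Suc.prems in auto)
  qed (simp_all del: of_nat_add)
qed simp

lemma choose_p_minus_1_Suc:
  "of_nat (k + 1) * ((-1) ^ Suc k * of_nat ((p - 1) choose Suc k))
    = (of_nat (k + 1) - of_nat p) * ((-1) ^ k * of_nat ((p - 1) choose k) :: rat)"
proof -
  have "of_nat (k + 1) * ((-1) ^ Suc k * (of_nat ((p - 1) choose Suc k) :: rat))
      = - ((-1) ^ k * (of_nat (Suc k) * of_nat ((p - 1) choose Suc k)))"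
    by (simp only: Suc_eq_plus1 power_Suc) simp
  then show ?thesis
    unfolding of_nat_choose_Suc using pn by (simp add: algebra_simps)
qed

lemma choose_p_minus_1_cong: "k < p \<Longrightarrow> rat_cong p 1 ((-1) ^ k * of_nat ((p - 1) choose k)) 1"
proof (induction k)
  case (Suc k)
  show ?case
  proof (rule rat_cong_step[OF _ choose_p_minus_1_Suc])
    show "rat_cong p 1 ((-1) ^ k * of_nat ((p - 1) choose k)) 1" using Suc by simp
    show "rat_cong p 1 (of_nat (k + 1) - of_nat p) (of_nat (k + 1))"
      by (rule rat_congI[of p "-1"]) auto
    show "p_integral p (1 / of_nat (k + 1))"
      by (rule p_integral_inverse) (use Suc.prems in auto)
  qed (simp_all del: of_nat_add)
qed simp

text \<open>Each index j contributes (1 + p/j) (1 - p/j) = 1 - p^2/j^2.\<close>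

lemma choose_mult_choose_p_cong:
  "k < p \<Longrightarrow> rat_cong p 2 (of_nat ((p + k) choose k) * ((-1) ^ k * of_nat ((p - 1) choose k))) 1"
proof (induction k)
  case (Suc k)
  show ?case
  proof (rule rat_cong_step)
    show "rat_cong p 2 (of_nat ((p + k) choose k) * ((-1) ^ k * of_nat ((p - 1) choose k))) 1" using Suc by simp
    have "of_nat (k + 1) * of_nat ((p + Suc k) choose Suc k) = (of_nat p + of_nat (k + 1)) * (of_nat ((p + k) choose k) :: rat)"
      using arg_cong[OF Suc_times_binomial[of k "p + k"], of "of_nat :: nat \<Rightarrow> rat"]
      by (simp only: of_nat_mult add_Suc_right Suc_eq_plus1 of_nat_add add.assoc)
    from arg_cong2[OF this choose_p_minus_1_Suc[of k], of "(*)"]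
    show "of_nat (k + 1) ^ 2 * (of_nat ((p + Suc k) choose Suc k) * ((-1) ^ Suc k * of_nat ((p - 1) choose Suc k)))
      = ((of_nat p + of_nat (k + 1)) * (of_nat (k + 1) - of_nat p)) * (of_nat ((p + k) choose k) * ((-1) ^ k * of_nat ((p - 1) choose k)) :: rat)"
      by (simp only: power2_eq_square mult_ac)
    show "rat_cong p 2 ((of_nat p + of_nat (k + 1)) * (of_nat (k + 1) - of_nat p)) (of_nat (k + 1) ^ 2)"
      by (rule rat_congI[of p "-1"]) (auto simp: power2_eq_square algebra_simps)
    show "p_integral p (1 / of_nat (k + 1) ^ 2)"
      by (intro p_integral_inverse_power p_integral_inverse) (use Suc.prems in auto)
  qed simp_all
qed simp

text \<open>Linear extrapolation: for the upper index (t p - 1) / 2 the three binomials belong to t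
  = 3, 1, 0, and a linear function satisfies f(3) = 3 f(1) - 2 f(0). With three sequences in play,
  the induction follows the defect from linearity.\<close>

lemma choose_add_p_half_cong:
  "k \<le> n \<Longrightarrow> rat_cong p 2 (of_nat ((n + p) choose k)) (3 * of_nat (n choose k) - 2 * half_choose k)"
proof (induction k)
  case (Suc k)
  define y b h s :: rat where "y = of_nat ((n + p) choose k)" and "b = of_nat (n choose k)"
    and "h = half_choose k" and "s = of_nat (2 * k + 1)"
  have y: "rat_cong p 2 y (3 * b - 2 * h)" and bh: "rat_cong p 1 b h"
    using Suc half_choose_cong[of k] by (simp_all add: y_def b_def h_def)
  then have "rat_cong p 1 (y - b) ((3 * b - 2 * h) - b)"
    by (intro rat_cong_diff) (auto intro: rat_cong_mod_power_le)
  also have "rat_cong p 1 ((3 * b - 2 * h) - b) 0"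
    using rat_cong_scale[OF bh, of 2] rat_cong_zero_iff_diff[of p 1 "2 * b" "2 * h"] by (simp add: algebra_simps)
  finally have "rat_cong p (1 + 1) (of_nat p * (y - b)) 0"
    by (intro rat_cong_mult_zero rat_cong_of_nat_dvd) auto
  then have "rat_cong p 2 (3 * (of_nat p * (y - b))) (3 * 0)"
    by (intro rat_cong_scale) (auto simp: numeral_2_eq_2)
  moreover have "rat_cong p 2 (- s * (y - (3 * b - 2 * h))) (- s * 0)"
    using y by (intro rat_cong_scale) (auto simp: rat_cong_zero_iff_diff s_def simp del: of_nat_add of_nat_mult)
  ultimately have "rat_cong p 2 (3 * (of_nat p * (y - b)) + - s * (y - (3 * b - 2 * h))) 0"
    using rat_cong_add by fastforce
  moreover have "of_nat (2 * (k + 1)) * of_nat ((n + p) choose Suc k) = (3 * of_nat p - s) * y"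
    using of_nat_choose_Suc[of k "n + p"] by (simp add: of_nat_p y_def s_def algebra_simps)
  moreover have "of_nat (2 * (k + 1)) * of_nat (n choose Suc k) = (of_nat p - s) * b"
    using of_nat_choose_Suc[of k n] by (simp add: of_nat_p b_def s_def algebra_simps)
  moreover have "of_nat (2 * (k + 1)) * half_choose (Suc k) = - s * h"
    using half_choose_Suc[of k] by (simp add: s_def h_def)
  moreover have "q * (u - (3 * v - 2 * w)) = q * u - 3 * (q * v) + 2 * (q * w)" for q u v w :: rat
    by (simp add: algebra_simps)
  \<comment> \<open>Up to the unit 2(k + 1), the new defect is -s times the old one plus 3 p (y -
    b), and y = b modulo p makes the latter 0 modulo p^2.\<close>
  moreover have "(3 * of_nat p - s) * y - 3 * ((of_nat p - s) * b) + 2 * (- s * h) = 3 * (of_nat p * (y - b)) + - s * (y - (3 * b - 2 * h))"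
    by (simp add: algebra_simps)
  ultimately have "rat_cong p 2 (of_nat (2 * (k + 1)) * (of_nat ((n + p) choose Suc k) - (3 * of_nat (n choose Suc k) - 2 * half_choose (Suc k)))) (of_nat (2 * (k + 1)) * 0)"
    by (simp only: mult_zero_right)
  moreover have "p_integral p (1 / of_nat (2 * (k + 1)))"
    by (rule p_integral_inverse) (use Suc.prems pn in auto)
  ultimately show ?case
    by (subst rat_cong_zero_iff_diff[symmetric], rule rat_cong_cancel) auto
qed simp

section \<open>Splitting sums over 0..p-1, and the last Catalan number\<close>

lemma p_dvd_central_choose:
  assumes "n < k" "k < p" shows "p dvd ((2 * k) choose k)"
proof -
  have "fact k * fact k * ((2 * k) choose k) = (fact (2 * k) :: nat)"
    using binomial_fact_lemma[of k "2 * k"] by simp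
  moreover have "p dvd fact (2 * k)" "\<not> p dvd fact k"
    using assms p pn by (auto simp: prime_dvd_fact_iff)
  ultimately show ?thesis using p by (metis prime_dvd_mult_iff)
qed

text \<open>The index p - 1 has its own value \<open>e\<close>: the denominator p of
  \<open>catalan (p - 1)\<close> cancels a factor p of the binomial, so this term need not
  vanish.\<close>

lemma sum_cong_split:
  assumes "\<And>k. n < k \<Longrightarrow> k < p - 1 \<Longrightarrow> rat_cong p m (g k) 0"
    and "\<And>k. k \<le> n \<Longrightarrow> rat_cong p m (g k) (h k)" and "rat_cong p m (g (p - 1)) e"
  shows "rat_cong p m (\<Sum>k=0..p-1. g k) ((\<Sum>k\<le>n. h k) + e)"
proof -
  have "{0..p-1} = {..n} \<union> {n<..<p-1} \<union> {p-1}" using pn n_pos by auto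
  moreover have "{..n} \<inter> {n<..<p-1} = {}" "({..n} \<union> {n<..<p-1}) \<inter> {p-1} = {}" using pn n_pos by auto
  ultimately have "(\<Sum>k=0..p-1. g k) = (\<Sum>k\<le>n. g k) + (\<Sum>k\<in>{n<..<p-1}. g k) + g (p - 1)"
    by (simp add: sum.union_disjoint del: One_nat_def)
  moreover have "rat_cong p m (\<Sum>k\<in>{n<..<p-1}. g k) (\<Sum>k\<in>{n<..<p-1}. 0)"
    using assms(1) by (intro rat_cong_sum) auto
  moreover have "rat_cong p m (\<Sum>k\<le>n. g k) (\<Sum>k\<le>n. h k)"
    using assms(2) by (intro rat_cong_sum) auto
  ultimately show ?thesis
    using rat_cong_add[OF rat_cong_add assms(3)] by fastforce
qed

lemma sum_cong_split_0:
  assumes "\<And>k. n < k \<Longrightarrow> k < p \<Longrightarrow> rat_cong p m (g k) 0"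
    and "\<And>k. k \<le> n \<Longrightarrow> rat_cong p m (g k) (h k)"
  shows "rat_cong p m (\<Sum>k=0..p-1. g k) (\<Sum>k\<le>n. h k)"
proof -
  have "rat_cong p m (g (p - 1)) 0" using assms(1)[of "p - 1"] pn n_pos by simp
  then have "rat_cong p m (\<Sum>k=0..p-1. g k) ((\<Sum>k\<le>n. h k) + 0)"
    by (intro sum_cong_split) (auto intro: assms)
  then show ?thesis by (simp only: add_0_right)
qed

text \<open>(2p - 1) C_{p-1} = binom(2p-1,p-1), which is 1 modulo p, while 2p - 1 is -1.\<close>

lemma catalan_p_minus_1_cong: "rat_cong p 1 (catalan (p - 1)) (-1)"
proof (rule rat_cong_cancel)
  have "p * ((2 * p - 1) choose p) = (2 * p - 1) * ((2 * (p - 1)) choose (p - 1))"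
    using Suc_times_binomial[of "p - 1" "2 * (p - 1)"] pn by simp
  moreover have "((2 * p - 1) choose p) = ((p + (p - 1)) choose (p - 1))"
    using binomial_symmetric[of p "2 * p - 1"] pn by simp
  ultimately have "(of_nat p * of_nat ((p + (p - 1)) choose (p - 1)) :: rat) = of_nat (2 * p - 1) * of_nat ((2 * (p - 1)) choose (p - 1))"
    by (metis of_nat_mult)
  then have "of_nat (2 * p - 1) * catalan (p - 1) = of_nat ((p + (p - 1)) choose (p - 1))"
  proof -
    have "p - 1 + 1 = p" "(of_nat p :: rat) \<noteq> 0" using pn by auto
    moreover from this have "catalan (p - 1) = of_nat ((2 * (p - 1)) choose (p - 1)) / of_nat p"
      unfolding catalan_def by (simp only:) simp
    moreover have "u * (x / q) = c" if "q * c = u * x" "q \<noteq> 0" for u x q c :: rat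
      using that by (simp add: field_simps)
    ultimately show ?thesis
      using \<open>of_nat p * of_nat _ = _\<close> by (simp only:)
  qed
  moreover have "rat_cong p 1 (of_nat ((p + (p - 1)) choose (p - 1))) 1"
    by (rule choose_add_p_cong) (use pn in auto)
  moreover have "rat_cong p 1 1 (of_nat (2 * p - 1) * (-1))"
    by (rule rat_congI[of p 2]) (use pn in auto)
  ultimately show "rat_cong p 1 (of_nat (2 * p - 1) * catalan (p - 1)) (of_nat (2 * p - 1) * (-1))"
    by (metis rat_cong_trans)
  have "coprime (2 * p - 1) p"
  proof -
    have "coprime (Suc (2 * p - 1)) (2 * p - 1)" by (rule coprime_Suc_left_nat)
    moreover have "Suc (2 * p - 1) = 2 * p" using pn by simp
    ultimately have "coprime (2 * p) (2 * p - 1)" by (simp only:)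
    then have "coprime p (2 * p - 1)" by (simp only: coprime_mult_left_iff)
    then show ?thesis by (simp only: coprime_commute)
  qed
  moreover have "2 * p - 1 \<noteq> 0" using pn by simp
  ultimately show "p_integral p (1 / of_nat (2 * p - 1))" "of_nat (2 * p - 1) \<noteq> (0 :: rat)"
    by (simp_all only: p_integral_inverse_of_nat of_nat_eq_0_iff not_False_eq_True)
qed

end

section \<open>The sums for general odd p\<close>

lemma rat_cong_zero_scale: "rat_cong p m x 0 \<Longrightarrow> p_integral p c \<Longrightarrow> rat_cong p m (x * c) 0"
  using rat_cong_scale[of p m x 0 c] by (simp add: mult.commute)

lemma rat_cong_p_scale: "rat_cong p 1 x y \<Longrightarrow> rat_cong p 2 (of_nat p * x) (of_nat p * y)"
  unfolding rat_cong_iff by (auto simp: power2_eq_square algebra_simps simp flip: right_diff_distrib)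

context
  fixes p n :: nat
  assumes p: "prime p" and pn: "p = 2 * n + 1"
begin

lemmas [simp] = p_integral_half_choose[OF p pn]

lemma p_integral_inverse_power_2: "p_integral p (1 / 2 ^ i)"
  using p_integral_inverse_power[OF p pn p_integral_inverse_2[OF p pn]] .

lemma p_integral_inverse_16_32_64 [simp]: "p_integral p (1 / 16 ^ k)" "p_integral p (1 / 32 ^ k)" "p_integral p (1 / 64 ^ k)"
  using p_integral_inverse_power_2[of "4 * k"] p_integral_inverse_power_2[of "5 * k"] p_integral_inverse_power_2[of "6 * k"]
  by (simp_all add: power_mult)

lemma p_integral_divide_power_64 [simp]: "p_integral p x \<Longrightarrow> p_integral p (x / 64 ^ k)"
  by (rule p_integral_divide[OF p pn]) simp_all

lemma central_cong_0: "n < k \<Longrightarrow> k < p \<Longrightarrow> rat_cong p 1 (of_nat ((2 * k) choose k)) 0"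
  using p_dvd_central_choose[OF p pn] by (intro rat_cong_of_nat_dvd) simp

lemma catalan_eq: "catalan k = of_nat ((2 * k) choose k) * (1 / of_nat (k + 1))"
  by (simp add: catalan_def)

lemma catalan_cong_0: "n < k \<Longrightarrow> k < p - 1 \<Longrightarrow> rat_cong p 1 (catalan k) 0"
  unfolding catalan_eq
  by (intro rat_cong_zero_scale central_cong_0 p_integral_inverse[OF p pn]) auto

lemma rat_cong_power_0:
  assumes "rat_cong p 1 x 0" "k > 0" shows "rat_cong p 1 (x ^ k) 0"
  using rat_cong_power[OF assms(1), of k] assms(2) by (simp add: zero_power)

lemma inverse_power_p_minus_1_cong: "rat_cong p 1 (1 / 2 ^ (j * (p - 1))) 1"
proof (rule rat_cong_cancel)
  have "\<not> p dvd 2" using n_pos[OF p pn] pn dvd_imp_le[of p 2] by auto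
  then have "[2 ^ (p - 1) = 1] (mod p)" using fermat_theorem[OF p] by blast
  then have "[(2 ^ (p - 1)) ^ j = 1 ^ j] (mod p)" by (rule cong_pow)
  then have "[2 ^ (j * (p - 1)) = 1] (mod p)" by (simp add: power_mult[symmetric] mult.commute)
  then have "[int (2 ^ (j * (p - 1))) = int 1] (mod int p)" by (simp only: cong_int_iff)
  then have "rat_cong p 1 (2 ^ (j * (p - 1))) 1" using rat_cong_of_int[of "2 ^ (j * (p - 1))" 1 p 1] by simp
  then show "rat_cong p 1 (2 ^ (j * (p - 1)) * (1 / 2 ^ (j * (p - 1)))) (2 ^ (j * (p - 1)) * 1)"
    by (simp add: rat_cong_sym)
qed (simp_all add: p_integral_inverse_power_2)

lemma inverse_16_32_64_cong:
  "rat_cong p 1 (1 / 16 ^ (p - 1)) 1" "rat_cong p 1 (1 / 32 ^ (p - 1)) 1" "rat_cong p 1 (1 / 64 ^ (p - 1)) 1"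
  using inverse_power_p_minus_1_cong[of 4] inverse_power_p_minus_1_cong[of 5] inverse_power_p_minus_1_cong[of 6]
  by (simp_all add: power_mult)

lemma catalan_power_p_minus_1_cong:
  assumes "rat_cong p 1 (1 / c) 1"
  shows "rat_cong p 1 (catalan (p - 1) ^ k / c) ((-1) ^ k)"
proof -
  have "rat_cong p 1 (catalan (p - 1) ^ k * (1 / c)) ((-1) ^ k * 1)"
    by (intro rat_cong_mult rat_cong_power catalan_p_minus_1_cong[OF p pn] assms rat_cong_integral[OF assms]) simp_all
  then show ?thesis by simp
qed

lemma central_cube_eq: "of_nat ((2 * k) choose k) ^ 3 / 64 ^ k = (-1) ^ k * half_choose k ^ 3"
  by (simp add: half_choose_cube flip: power_mult_distrib)

lemma sum_cube_cong:
  "rat_cong p 1 (\<Sum>k=0..p-1. of_nat k ^ 3 * of_nat ((2 * k) choose k) ^ 3 / 64 ^ k)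
     (- (of_nat n ^ 3) * (\<Sum>j\<le>n - 1. (-1) ^ j * of_nat ((n - 1) choose j) ^ 3))"
proof -
  have "rat_cong p 1 (\<Sum>k=0..p-1. of_nat k ^ 3 * of_nat ((2 * k) choose k) ^ 3 / 64 ^ k)
      (\<Sum>k\<le>n. of_nat k ^ 3 * ((-1) ^ k * of_nat (n choose k) ^ 3))"
  proof (rule sum_cong_split_0[OF p pn])
    fix k assume "n < k" "k < p"
    then have "rat_cong p 1 (of_nat ((2 * k) choose k) ^ 3 * (of_nat k ^ 3 * (1 / 64 ^ k))) 0"
      by (intro rat_cong_zero_scale rat_cong_power_0 central_cong_0) simp_all
    then show "rat_cong p 1 (of_nat k ^ 3 * of_nat ((2 * k) choose k) ^ 3 / 64 ^ k) 0"
      by (simp add: mult_ac)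
  next
    fix k assume "k \<le> n"
    then show "rat_cong p 1 (of_nat k ^ 3 * of_nat ((2 * k) choose k) ^ 3 / 64 ^ k) (of_nat k ^ 3 * ((-1) ^ k * of_nat (n choose k) ^ 3))"
      unfolding times_divide_eq_right[symmetric] central_cube_eq
      by (intro rat_cong_scale rat_cong_power rat_cong_sym[OF half_choose_cong[OF p pn]]) simp_all
  qed
  also have "(\<Sum>k\<le>n. of_nat k ^ 3 * ((-1) ^ k * of_nat (n choose k) ^ 3))
      = - (of_nat n ^ 3) * (\<Sum>j\<le>n - 1. (-1) ^ j * (of_nat ((n - 1) choose j) :: rat) ^ 3)"
  proof -
    obtain n' where n': "n = Suc n'" using n_pos[OF p pn] by (cases n) auto
    \<comment> \<open>Shifting the index by one produces the minus sign; the term k = 0 is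
      zero.\<close>
    have "of_nat (Suc j) ^ 3 * ((-1) ^ Suc j * (of_nat (Suc n' choose Suc j) :: rat) ^ 3)
        = - (of_nat (Suc n') ^ 3) * ((-1) ^ j * of_nat (n' choose j) ^ 3)" for j
    proof -
      have "(of_nat (Suc j) :: rat) * of_nat (Suc n' choose Suc j) = of_nat (Suc n') * of_nat (n' choose j)"
        by (metis Suc_times_binomial of_nat_mult)
      then have "(of_nat (Suc j) * of_nat (Suc n' choose Suc j) :: rat) ^ 3 = (of_nat (Suc n') * of_nat (n' choose j)) ^ 3"
        by (simp only:)
      then show ?thesis unfolding power_mult_distrib by (simp add: mult_ac)
    qed
    then show ?thesis
      unfolding n' sum.atMost_Suc_shift by (simp add: sum_distrib_left del: of_nat_Suc binomial_Suc_Suc power_Suc)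
  qed
  finally show ?thesis .
qed

lemma choose_div_Suc: "of_nat (n choose k) * (1 / of_nat (k + 1)) = (of_nat (Suc n choose Suc k) / of_nat (Suc n) :: rat)"
proof -
  have "(of_nat (Suc k) :: rat) * of_nat (Suc n choose Suc k) = of_nat (Suc n) * of_nat (n choose k)"
    by (metis Suc_times_binomial of_nat_mult)
  moreover have "(of_nat (Suc k) :: rat) \<noteq> 0" "(of_nat (Suc n) :: rat) \<noteq> 0" by (simp_all only: of_nat_eq_0_iff Suc_not_Zero not_False_eq_True)
  ultimately show ?thesis by (simp add: field_simps del: of_nat_Suc binomial_Suc_Suc)
qed

lemma half_choose_div_Suc_cong:
  "k \<le> n \<Longrightarrow> rat_cong p 1 (half_choose k * (1 / of_nat (k + 1))) (of_nat (Suc n choose Suc k) / of_nat (Suc n))"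
  unfolding choose_div_Suc[symmetric] mult.commute[of _ "1 / of_nat (k + 1)"]
  by (intro rat_cong_scale rat_cong_sym[OF half_choose_cong[OF p pn]] p_integral_inverse[OF p pn]) (use pn n_pos[OF p pn] in auto)

lemma p_integral_choose_div_Suc [simp]: "p_integral p (of_nat a / of_nat (Suc n))"
  by (rule p_integral_divide[OF p pn _ p_integral_inverse[OF p pn]]) (use pn n_pos[OF p pn] in auto)

lemma catalan_square_eq: "catalan k ^ 2 / 16 ^ k = (half_choose k * (1 / of_nat (k + 1))) ^ 2"
  unfolding power_mult_distrib half_choose_sq catalan_eq by (simp add: power2_eq_square)

lemma catalan_cube_eq: "catalan k ^ 3 / 64 ^ k = (-1) ^ k * (half_choose k * (1 / of_nat (k + 1))) ^ 3"
  unfolding power_mult_distrib mult.assoc[symmetric] central_cube_eq[symmetric] catalan_eq by simp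

lemma catalan_cube_sum_cong:
  "rat_cong p 1 (\<Sum>k=0..p-1. catalan k ^ 3 / 64 ^ k)
    (7 - 8 * (\<Sum>j\<le>n + 1. (-1) ^ j * of_nat ((n + 1) choose j) ^ 3))"
proof -
  define D q :: rat where "D = (\<Sum>j\<le>n + 1. (-1) ^ j * of_nat ((n + 1) choose j) ^ 3)" and "q = of_nat (Suc n)"
  have q: "of_nat p = 2 * q - 1" "q \<noteq> 0" unfolding q_def pn by simp_all
  have "rat_cong p 1 (\<Sum>k=0..p-1. catalan k ^ 3 / 64 ^ k)
      ((\<Sum>k\<le>n. (-1) ^ k * (of_nat (Suc n choose Suc k) / of_nat (Suc n)) ^ 3) + (-1) ^ 3)"
  proof (rule sum_cong_split[OF p pn])
    fix k assume "n < k" "k < p - 1"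
    then have "rat_cong p 1 (catalan k ^ 3 * (1 / 64 ^ k)) 0"
      by (intro rat_cong_zero_scale rat_cong_power_0 catalan_cong_0) simp_all
    then show "rat_cong p 1 (catalan k ^ 3 / 64 ^ k) 0" by simp
  next
    fix k assume "k \<le> n"
    then show "rat_cong p 1 (catalan k ^ 3 / 64 ^ k) ((-1) ^ k * (of_nat (Suc n choose Suc k) / of_nat (Suc n)) ^ 3)"
      unfolding catalan_cube_eq by (intro rat_cong_scale rat_cong_power half_choose_div_Suc_cong)
        (simp_all del: of_nat_Suc binomial_Suc_Suc)
  qed (intro catalan_power_p_minus_1_cong inverse_16_32_64_cong)
  \<comment> \<open>\<open>D\<close> also contains j = 0, with the value 1, which has no counterpart
    in the Catalan sum; the final -1 is the term k = p - 1.\<close>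
  also have "(\<Sum>k\<le>n. (-1) ^ k * ((of_nat (Suc n choose Suc k) :: rat) / of_nat (Suc n)) ^ 3) + (-1) ^ 3 = (1 - D) / q ^ 3 - 1"
    unfolding D_def q_def Suc_eq_plus1[symmetric] sum.atMost_Suc_shift
    by (simp add: power_divide sum_divide_distrib sum_negf of_nat_Suc[of 0] del: of_nat_Suc binomial_Suc_Suc)
  also have "rat_cong p 1 ((1 - D) / q ^ 3 - 1) (7 - 8 * D)"
  proof (rule rat_congI)
    have "p_integral p D" unfolding D_def by (intro p_integral_sum) simp
    moreover have "p_integral p (1 / q)" unfolding q_def using p_integral_choose_div_Suc[of 1] by simp
    ultimately show "p_integral p ((D - 1) * (of_nat p ^ 2 + 3 * of_nat p + 3) * (1 / q) ^ 3)" by simp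
    \<comment> \<open>As 2q = p + 1, this factors (2q)^3 - 1 and shows that 1 / q^3 is 8 modulo
      p.\<close>
    have "8 * q ^ 3 - 1 = of_nat p * (of_nat p ^ 2 + 3 * of_nat p + 3)"
      unfolding q by (simp add: algebra_simps power2_eq_square power3_eq_cube)
    then have "of_nat p ^ 1 * ((D - 1) * (of_nat p ^ 2 + 3 * of_nat p + 3) * (1 / q) ^ 3) = (D - 1) * (8 * q ^ 3 - 1) / q ^ 3"
      by (simp add: power_divide mult_ac)
    moreover have "(1 - D) / q ^ 3 - 1 - (7 - 8 * D) = (D - 1) * (8 * q ^ 3 - 1) / q ^ 3"
      using q(2) by (simp add: field_simps)
    ultimately show "(1 - D) / q ^ 3 - 1 - (7 - 8 * D) = of_nat p ^ 1 * ((D - 1) * (of_nat p ^ 2 + 3 * of_nat p + 3) * (1 / q) ^ 3)"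
      by (simp only:)
  qed
  finally show ?thesis unfolding D_def .
qed

lemma catalan_square_sum_cong: "rat_cong p 1 (\<Sum>k=0..p-1. catalan k ^ 2 / 16 ^ k) (-3)"
proof -
  define q :: rat where "q = of_nat (Suc n)"
  have q: "of_nat p = 2 * q - 1" "q \<noteq> 0" unfolding q_def pn by simp_all
  \<comment> \<open>The sum of squares will be binom(p+1,n+1), which Pascal's rule splits into these
    two multiples of p.\<close>
  have "p dvd (p choose n)" "p dvd (p choose Suc n)"
    using n_pos[OF p pn] pn by (intro dvd_choose_prime[OF _ _ _ p]; linarith)+
  moreover have "2 * Suc n = Suc p" using pn by simp
  ultimately have "p dvd ((2 * Suc n) choose Suc n)" by (simp only: binomial_Suc_Suc dvd_add)
  then obtain b where b: "((2 * Suc n) choose Suc n) = p * b" by (rule dvdE)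
  have "rat_cong p 1 (\<Sum>k=0..p-1. catalan k ^ 2 / 16 ^ k)
      ((\<Sum>k\<le>n. (of_nat (Suc n choose Suc k) / of_nat (Suc n)) ^ 2) + (-1) ^ 2)"
  proof (rule sum_cong_split[OF p pn])
    fix k assume "n < k" "k < p - 1"
    then have "rat_cong p 1 (catalan k ^ 2 * (1 / 16 ^ k)) 0"
      by (intro rat_cong_zero_scale rat_cong_power_0 catalan_cong_0) simp_all
    then show "rat_cong p 1 (catalan k ^ 2 / 16 ^ k) 0" by simp
  next
    fix k assume "k \<le> n"
    then show "rat_cong p 1 (catalan k ^ 2 / 16 ^ k) ((of_nat (Suc n choose Suc k) / of_nat (Suc n)) ^ 2)"
      unfolding catalan_square_eq by (intro rat_cong_power half_choose_div_Suc_cong)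
        (simp_all del: of_nat_Suc binomial_Suc_Suc)
  qed (intro catalan_power_p_minus_1_cong inverse_16_32_64_cong)
  \<comment> \<open>The -1 removes the square with j = 0, and the +1 is the term k = p - 1. Since 1
    / q^2 is 4 modulo p, -4 + 1 remains.\<close>
  also have "(\<Sum>k\<le>n. ((of_nat (Suc n choose Suc k) :: rat) / of_nat (Suc n)) ^ 2) + (-1) ^ 2 = (of_nat (p * b) - 1) / q ^ 2 + 1"
    unfolding b[symmetric] q_def choose_square_sum[symmetric] sum.atMost_Suc_shift
    by (simp add: power_divide sum_divide_distrib of_nat_Suc[of "\<Sum>i\<le>n. (Suc n choose Suc i)\<^sup>2"]
        del: of_nat_Suc binomial_Suc_Suc)
  also have "rat_cong p 1 ((of_nat (p * b) - 1) / q ^ 2 + 1) (-3)"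
  proof (rule rat_congI)
    have "p_integral p (1 / q)" unfolding q_def using p_integral_choose_div_Suc[of 1] by simp
    then show "p_integral p ((of_nat b + of_nat p + 2) * (1 / q) ^ 2)" by simp
    have "4 * q ^ 2 - 1 = of_nat p * (of_nat p + 2)"
      unfolding q by (simp add: algebra_simps power2_eq_square)
    then have "of_nat p * (of_nat b + of_nat p + 2) = of_nat (p * b) - 1 + 4 * q ^ 2"
      by (simp add: algebra_simps)
    then have "of_nat p ^ 1 * ((of_nat b + of_nat p + 2) * (1 / q) ^ 2) = (of_nat (p * b) - 1 + 4 * q ^ 2) / q ^ 2"
      by (simp add: power_divide)
    moreover have "(of_nat (p * b) - 1) / q ^ 2 + 1 - (-3) = (of_nat (p * b) - 1 + 4 * q ^ 2) / q ^ 2"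
      using q(2) by (simp add: field_simps)
    ultimately show "(of_nat (p * b) - 1) / q ^ 2 + 1 - (-3) = of_nat p ^ 1 * ((of_nat b + of_nat p + 2) * (1 / q) ^ 2)"
      by (simp only:)
  qed
  finally show ?thesis .
qed

lemma central_catalan_sum_cong:
  "rat_cong p 2 (\<Sum>k=0..p-1. of_nat ((2 * k) choose k) * catalan k / 32 ^ k) (legendre_integral n + of_nat p)"
  unfolding legendre_integral_def
proof (rule sum_cong_split[OF p pn])
  \<comment> \<open>The binomial and the Catalan number contribute one factor p each.\<close>
  fix k assume "n < k" "k < p - 1"
  then have "rat_cong p (1 + 1) (of_nat ((2 * k) choose k) * catalan k) 0"
    by (intro rat_cong_mult_zero central_cong_0 catalan_cong_0) auto
  then have "rat_cong p 2 (of_nat ((2 * k) choose k) * catalan k) 0" by (simp only: one_add_one)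
  then have "rat_cong p 2 (of_nat ((2 * k) choose k) * catalan k * (1 / 32 ^ k)) 0"
    by (rule rat_cong_zero_scale) simp
  then show "rat_cong p 2 (of_nat ((2 * k) choose k) * catalan k / 32 ^ k) 0" by simp
next
  fix k assume k: "k \<le> n"
  have "rat_cong p 2 (1 / 2 ^ k * (1 / of_nat (k + 1)) * half_choose k ^ 2)
      (1 / 2 ^ k * (1 / of_nat (k + 1)) * ((-1) ^ k * of_nat ((n choose k) * ((n + k) choose k))))"
    by (intro rat_cong_scale rat_cong_sym[OF half_choose_sq_cong[OF p pn k]] p_integral_mult
        p_integral_inverse_power_2 p_integral_inverse[OF p pn]) (use k pn n_pos[OF p pn] in auto)
  moreover have "(32 :: rat) ^ k = 2 ^ k * 16 ^ k" by (simp flip: power_mult_distrib)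
  then have "of_nat ((2 * k) choose k) * catalan k / 32 ^ k = 1 / 2 ^ k * (1 / of_nat (k + 1)) * half_choose k ^ 2"
    unfolding half_choose_sq catalan_eq by (simp add: power2_eq_square mult_ac)
  moreover have "x * (-1/2) ^ k / y = 1 / 2 ^ k * (1 / y) * ((-1) ^ k * x)" for x y :: rat
    by (simp only: power_divide) simp
  ultimately show "rat_cong p 2 (of_nat ((2 * k) choose k) * catalan k / 32 ^ k)
      (of_nat ((n choose k) * ((n + k) choose k)) * (-1/2) ^ k / of_nat (k + 1))"
    by (simp only:)
next
  \<comment> \<open>At k = p - 1 the binomial is p times the Catalan number, so the values modulo p
    of the remaining factors suffice.\<close>
  have "rat_cong p 2 (of_nat p * (catalan (p - 1) ^ 2 / 32 ^ (p - 1))) (of_nat p * (-1) ^ 2)"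
    by (intro rat_cong_p_scale catalan_power_p_minus_1_cong inverse_16_32_64_cong)
  moreover have "of_nat ((2 * (p - 1)) choose (p - 1)) = of_nat p * catalan (p - 1)"
  proof -
    have "p - 1 + 1 = p" using pn by simp
    then show ?thesis unfolding catalan_eq using pn by (simp only:) simp
  qed
  ultimately show "rat_cong p 2 (of_nat ((2 * (p - 1)) choose (p - 1)) * catalan (p - 1) / 32 ^ (p - 1)) (of_nat p)"
    by (simp add: power2_eq_square mult.assoc)
qed

end

section \<open>The alternating cube sum modulo p squared\<close>

context
  fixes p n :: nat
  assumes p: "prime p" and pn: "p = 2 * n + 1"
begin

lemma p_dvd_choose_n_add_p: "n < k \<Longrightarrow> k < p \<Longrightarrow> p dvd ((n + p) choose k)"
proof -
  assume k: "n < k" "k < p"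
  have "fact k * fact (n + p - k) * ((n + p) choose k) = (fact (n + p) :: nat)"
    using binomial_fact_lemma[of k "n + p"] k by simp
  moreover have "p dvd fact (n + p)" "\<not> p dvd fact k" "\<not> p dvd fact (n + p - k)"
    using k p by (auto simp: prime_dvd_fact_iff)
  ultimately show ?thesis using p by (metis prime_dvd_mult_iff)
qed

text \<open>
  The top index \<open>n + p = (3 * p - 1) div 2\<close> is congruent to \<open>n\<close> modulo \<open>p\<close> and even, so that Dixon's
  identity gives a non-trivial product with two factors \<open>p\<close>.
\<close>

lemma sum_choose_n_add_p_cong:
  assumes "odd n"
  shows "rat_cong p 2 (\<Sum>k\<le>n. (-1) ^ k * of_nat ((n + p) choose k) ^ 3) 0"
proof -
  define y :: "nat \<Rightarrow> rat" where "y k = (-1) ^ k * of_nat ((n + p) choose k) ^ 3" for k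
  have "even (n + p)" using assms pn by simp
  then obtain a where a: "n + p = 2 * a" by (rule evenE)
  \<comment> \<open>The reflection keeps the sign because the upper index is even, and it exchanges
    the ranges k <= n and k >= p. Dixon's sum is therefore twice the wanted half plus middle terms
    divisible by p^3.\<close>
  have sym: "y (n + p - k) = y k" if "k \<le> n + p" for k
  proof -
    have "(-1) ^ (n + p - k) = ((-1) ^ k :: rat)"
      using that \<open>even (n + p)\<close> by (simp add: minus_one_power_iff)
    then show ?thesis using binomial_symmetric[OF that] by (simp add: y_def)
  qed
  have "{..2 * a} = {..n} \<union> {n<..<p} \<union> {p..n + p}"
    unfolding a[symmetric] using pn by auto
  moreover have "{..n} \<inter> {n<..<p} = {}" "({..n} \<union> {n<..<p}) \<inter> {p..n + p} = {}" using pn by auto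
  ultimately have "(\<Sum>k\<le>2 * a. y k) = (\<Sum>k\<le>n. y k) + (\<Sum>k\<in>{n<..<p}. y k) + (\<Sum>k\<in>{p..n + p}. y k)"
    by (simp add: sum.union_disjoint)
  also have "(\<Sum>k\<in>{p..n + p}. y k) = (\<Sum>k\<le>n. y k)"
    by (rule sum.reindex_bij_witness[of _ "\<lambda>k. n + p - k" "\<lambda>k. n + p - k"]) (auto simp: sym)
  finally have split: "2 * (\<Sum>k\<le>n. y k) = (\<Sum>k\<le>2 * a. y k) - (\<Sum>k\<in>{n<..<p}. y k)"
    by simp
  have "rat_cong p 2 (y k) 0" if "n < k" "k < p" for k
  proof -
    have "p ^ 3 dvd ((n + p) choose k) ^ 3"
      using p_dvd_choose_n_add_p[OF that] by (rule dvd_power_same)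
    then have "p ^ 2 dvd ((n + p) choose k) ^ 3"
      using power_le_dvd[of p 3 _ 2] by simp
    then have "rat_cong p 2 (of_nat (((n + p) choose k) ^ 3)) 0" by (rule rat_cong_of_nat_dvd)
    from rat_cong_scale[OF this, of "(-1) ^ k"] show ?thesis by (simp add: y_def)
  qed
  then have "rat_cong p 2 (\<Sum>k\<in>{n<..<p}. y k) (\<Sum>k\<in>{n<..<p}. 0)"
    by (intro rat_cong_sum) auto
  moreover have "rat_cong p 2 (\<Sum>k\<le>2 * a. y k) 0"
  proof -
    let ?B = "((3 * a) choose a) * ((2 * a) choose a)"
    have "a < p" "2 * p \<le> 3 * a" using a pn n_pos[OF p pn] by auto
    then have "\<not> p dvd fact a" using p by (auto simp: prime_dvd_fact_iff)
    then have "coprime (p ^ 2) (fact a ^ 3)" using p prime_imp_coprime by auto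
    \<comment> \<open>As 3a >= 2p, the factorial of 3a contains the factors p and 2p, while a < p
      keeps \<open>fact a\<close> prime to p.\<close>
    moreover have "p ^ 2 dvd ?B * fact a ^ 3"
    proof -
      have "fact (2 * p) = (2 * p) * (fact (2 * p - 1) :: nat)" using pn by (subst fact_reduce) auto
      moreover have "p dvd fact (2 * p - 1)"
        unfolding prime_dvd_fact_iff[OF p] using pn by simp
      ultimately have "p * p dvd (fact (2 * p) :: nat)" by (metis dvd_triv_right mult_dvd_mono)
      also have "fact (2 * p) dvd (fact (3 * a) :: nat)" using \<open>2 * p \<le> 3 * a\<close> by (rule fact_dvd)
      finally show ?thesis unfolding choose_choose_mult_fact by (simp add: power2_eq_square)
    qed
    ultimately have "p ^ 2 dvd ?B" by (metis coprime_dvd_mult_left_iff)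
    then have "rat_cong p 2 ((-1) ^ a * of_nat ?B) ((-1) ^ a * 0)"
      by (intro rat_cong_scale rat_cong_of_nat_dvd) simp_all
    then show ?thesis
      unfolding y_def a dixon_even by simp
  qed
  ultimately have "rat_cong p 2 (2 * (\<Sum>k\<le>n. y k)) (2 * 0)"
    unfolding split using rat_cong_diff by fastforce
  then show ?thesis
    unfolding y_def[symmetric] by (rule rat_cong_cancel) (simp_all add: p_integral_inverse_2[OF p pn])
qed

lemma cube_perturb:
  assumes "p_integral p b" "p_integral p v"
  shows "rat_cong p 2 ((b + of_nat p * v) ^ 3) (b ^ 3 + 3 * of_nat p * (b ^ 2 * v))"
  by (rule rat_congI[of p "3 * b * v ^ 2 + of_nat p * v ^ 3"])
    (use assms in \<open>auto simp: power2_eq_square power3_eq_cube algebra_simps\<close>)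

text \<open>With h = b + p v, extrapolation gives y = b - 2 p v. To first order the cubes are b^3 +
  3 p b^2 v and b^3 - 6 p b^2 v, and 3 b^3 minus the second is twice the first.\<close>

lemma half_choose_cube_cong:
  assumes "k \<le> n"
  shows "rat_cong p 2 (2 * half_choose k ^ 3) (3 * of_nat (n choose k) ^ 3 - of_nat ((n + p) choose k) ^ 3)"
proof -
  define b :: rat where "b = of_nat (n choose k)"
  obtain v where v: "p_integral p v" "half_choose k - b = of_nat p * v"
    using rat_cong_sym[OF half_choose_cong[OF p pn assms]] unfolding rat_cong_iff b_def by auto
  have h: "half_choose k = b + of_nat p * v" using v(2) by simp
  have "rat_cong p 2 (of_nat ((n + p) choose k)) (b + of_nat p * (- 2 * v))"
    using choose_add_p_half_cong[OF p pn assms] unfolding b_def[symmetric] h by (simp add: algebra_simps)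
  then have "rat_cong p 2 (of_nat ((n + p) choose k) ^ 3) ((b + of_nat p * (- 2 * v)) ^ 3)"
    by (rule rat_cong_power) (use v in \<open>simp add: b_def\<close>)
  also have "rat_cong p 2 ((b + of_nat p * (- 2 * v)) ^ 3) (b ^ 3 + 3 * of_nat p * (b ^ 2 * (- 2 * v)))"
    by (rule cube_perturb) (use v in \<open>simp_all add: b_def\<close>)
  finally have "rat_cong p 2 (3 * b ^ 3 - of_nat ((n + p) choose k) ^ 3) (3 * b ^ 3 - (b ^ 3 + 3 * of_nat p * (b ^ 2 * (- 2 * v))))"
    by (intro rat_cong_diff rat_cong_refl)
  also have "3 * b ^ 3 - (b ^ 3 + 3 * of_nat p * (b ^ 2 * (- 2 * v))) = 2 * (b ^ 3 + 3 * of_nat p * (b ^ 2 * v))"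
    by simp
  also have "rat_cong p 2 \<dots> (2 * (b + of_nat p * v) ^ 3)"
    by (intro rat_cong_sym[of p 2 "2 * (b + of_nat p * v) ^ 3"] rat_cong_scale cube_perturb) (use v in \<open>simp_all add: b_def\<close>)
  finally show ?thesis
    unfolding h b_def[symmetric] by (rule rat_cong_sym)
qed

text \<open>Exactly, binom(n+p,n-k) binom(p+k,k) = binom(n+p,n) binom(n,k), both being (n+p)! / (k!
  (n-k)! p!). Modulo p^2 the inverse of binom(p+k,k) is the signed binomial, by
  \<open>choose_mult_choose_p_cong\<close>.\<close>

lemma choose_n_add_p_reflect_cong:
  assumes "k \<le> n"
  shows "rat_cong p 2 (of_nat ((n + p) choose (n - k)))
    (of_nat ((n + p) choose n) * (of_nat (n choose k) * ((-1) ^ k * of_nat ((p - 1) choose k))))"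
proof -
  define w e :: rat where "w = (-1) ^ k * of_nat ((p - 1) choose k)" and "e = of_nat ((p + k) choose k)"
  have "p + k \<le> n + p" "n + p - (p + k) = n - k" using assms by auto
  then have "((n + p) choose (n - k)) * ((p + k) choose k) = ((n + p) choose k) * (((n + p) - k) choose p)"
    using choose_mult[of k "p + k" "n + p"] binomial_symmetric[of "p + k" "n + p"] by simp
  also have "((n + p) - k) choose p = (n + p - k) choose (n - k)"
    using binomial_symmetric[of p "n + p - k"] assms by simp
  also have "((n + p) choose k) * ((n + p - k) choose (n - k)) = ((n + p) choose n) * (n choose k)"
    using choose_mult[of k n "n + p"] assms by simp
  finally have eq: "of_nat ((n + p) choose (n - k)) * e = of_nat ((n + p) choose n) * (of_nat (n choose k) :: rat)"
    unfolding e_def by (metis of_nat_mult)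
  have "rat_cong p 2 (e * w) 1"
    unfolding e_def w_def by (rule choose_mult_choose_p_cong[OF p pn]) (use assms pn in auto)
  then have "rat_cong p 2 (of_nat ((n + p) choose (n - k)) * (e * w)) (of_nat ((n + p) choose (n - k)) * 1)"
    by (rule rat_cong_scale) simp
  moreover have "of_nat ((n + p) choose (n - k)) * (e * w) = of_nat ((n + p) choose n) * (of_nat (n choose k) * w)"
    using eq by (simp only: mult.assoc[symmetric])
  ultimately show ?thesis unfolding w_def[symmetric] by (simp add: rat_cong_sym)
qed

text \<open>The two sides differ by (x - y) (u - w), a product of two multiples of p.\<close>

lemma mult_cong_perturb:
  assumes "rat_cong p 1 x y" "rat_cong p 1 u w" shows "rat_cong p 2 (x * u + y * w) (x * w + y * u)"
proof -
  have "rat_cong p (1 + 1) ((x - y) * (u - w)) 0"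
    by (intro rat_cong_mult_zero) (simp_all only: rat_cong_zero_iff_diff assms)
  moreover have "x * u + y * w - (x * w + y * u) = (x - y) * (u - w)" by (simp add: algebra_simps)
  ultimately show ?thesis
    unfolding rat_cong_zero_iff_diff[symmetric, of p 2 "x * u + y * w"] by (simp add: numeral_2_eq_2)
qed

lemma p_integral_inverse_3: "p > 3 \<Longrightarrow> p_integral p (1 / 3)"
  using p_integral_inverse[OF p pn, of 3] by simp

lemma sum_choose_central_cube_cong:
  assumes "odd n" "p > 3"
  shows "rat_cong p 2 (\<Sum>k=0..p-1. of_nat ((p - 1) choose k) * (of_nat ((2 * k) choose k) ^ 3 / (-64) ^ k)) 0"
proof -
  define w b h y :: "nat \<Rightarrow> rat" where "w k = (-1) ^ k * of_nat ((p - 1) choose k)" and "b k = of_nat (n choose k)"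
    and "h k = half_choose k" and "y k = of_nat ((n + p) choose k)" for k
  define c :: rat where "c = of_nat ((n + p) choose n)"
  have w_int [simp]: "p_integral p (w k)" and b_int [simp]: "p_integral p (b k)" and h_int [simp]: "p_integral p (h k)"
    and y_int [simp]: "p_integral p (y k)" and c_int [simp]: "p_integral p c" for k
    by (simp_all add: w_def b_def h_def y_def c_def p_integral_half_choose[OF p pn])
  have w: "rat_cong p 1 (w k) 1" if "k \<le> n" for k
    unfolding w_def by (rule choose_p_minus_1_cong[OF p pn]) (use that pn in auto)
  have y0: "rat_cong p 2 (\<Sum>k\<le>n. (-1) ^ k * y k ^ 3) 0"
    unfolding y_def by (rule sum_choose_n_add_p_cong[OF assms(1)])
  have b0: "(\<Sum>k\<le>n. (-1) ^ k * b k ^ 3) = 0"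
    unfolding b_def by (rule dixon_odd[OF assms(1)])
  have h0: "rat_cong p 2 (\<Sum>k\<le>n. (-1) ^ k * h k ^ 3) 0"
  proof (rule rat_cong_cancel)
    have "rat_cong p 2 (\<Sum>k\<le>n. (-1) ^ k * (2 * h k ^ 3)) (\<Sum>k\<le>n. (-1) ^ k * (3 * b k ^ 3 - y k ^ 3))"
      unfolding h_def b_def y_def by (intro rat_cong_sum rat_cong_scale half_choose_cube_cong) auto
    also have "(\<Sum>k\<le>n. (-1) ^ k * (3 * b k ^ 3 - y k ^ 3)) = 3 * (\<Sum>k\<le>n. (-1) ^ k * b k ^ 3) - (\<Sum>k\<le>n. (-1) ^ k * y k ^ 3)"
      by (simp add: sum_distrib_left right_diff_distrib sum_subtractf mult.left_commute)
    also have "rat_cong p 2 \<dots> (3 * 0 - 0)"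
      unfolding b0 by (intro rat_cong_diff y0 rat_cong_refl)
    finally show "rat_cong p 2 (2 * (\<Sum>k\<le>n. (-1) ^ k * h k ^ 3)) (2 * 0)"
      by (simp add: sum_distrib_left mult.left_commute)
  qed (simp_all add: p_integral_inverse_2[OF p pn])
  \<comment> \<open>Since w = 1 modulo p, w^3 is 3w - 2 modulo p^2. The cubed reflection formula
    thus becomes linear in w and can be solved for w b^3 after division by 3 c^3.\<close>
  have wb0: "rat_cong p 2 (\<Sum>k\<le>n. (-1) ^ k * (w k * b k ^ 3)) 0"
  proof (rule rat_cong_cancel)
    have "rat_cong p 2 ((-1) ^ k * (3 * c ^ 3 * (w k * b k ^ 3))) ((-1) ^ k * (y (n - k) ^ 3 + 2 * c ^ 3 * b k ^ 3))"
      if k: "k \<le> n" for k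
    proof -
      obtain u where u: "p_integral p u" "w k - 1 = of_nat p * u"
        using w[OF k] unfolding rat_cong_iff by auto
      then have wu: "w k = 1 + of_nat p * u" by simp
      have "rat_cong p 2 (w k ^ 3) (1 + 3 * of_nat p * u)"
        unfolding wu using cube_perturb[of 1 u] u by simp
      then have w3: "rat_cong p 2 (w k ^ 3) (3 * w k - 2)" by (simp add: wu algebra_simps)
      have "rat_cong p 2 (y (n - k) ^ 3) ((c * (b k * w k)) ^ 3)"
        unfolding y_def c_def b_def w_def
        by (intro rat_cong_power choose_n_add_p_reflect_cong k) simp
      also have "(c * (b k * w k)) ^ 3 = c ^ 3 * b k ^ 3 * w k ^ 3" by (simp add: power_mult_distrib)
      also have "rat_cong p 2 (c ^ 3 * b k ^ 3 * w k ^ 3) (c ^ 3 * b k ^ 3 * (3 * w k - 2))"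
        by (intro rat_cong_scale w3) simp
      finally have "rat_cong p 2 (y (n - k) ^ 3 + 2 * c ^ 3 * b k ^ 3) (c ^ 3 * b k ^ 3 * (3 * w k - 2) + 2 * c ^ 3 * b k ^ 3)"
        by (intro rat_cong_add rat_cong_refl)
      also have "c ^ 3 * b k ^ 3 * (3 * w k - 2) + 2 * c ^ 3 * b k ^ 3 = 3 * c ^ 3 * (w k * b k ^ 3)"
        by (simp add: algebra_simps)
      finally show ?thesis by (rule rat_cong_scale[OF rat_cong_sym]) simp
    qed
    then have "rat_cong p 2 (\<Sum>k\<le>n. (-1) ^ k * (3 * c ^ 3 * (w k * b k ^ 3))) (\<Sum>k\<le>n. (-1) ^ k * (y (n - k) ^ 3 + 2 * c ^ 3 * b k ^ 3))"
      by (intro rat_cong_sum) auto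
    also have "(\<Sum>k\<le>n. (-1) ^ k * (y (n - k) ^ 3 + 2 * c ^ 3 * b k ^ 3))
        = (\<Sum>k\<le>n. (-1) ^ k * y (n - k) ^ 3) + 2 * c ^ 3 * (\<Sum>k\<le>n. (-1) ^ k * b k ^ 3)"
      by (simp add: sum_distrib_left distrib_left sum.distrib mult_ac)
    \<comment> \<open>Reversal changes every sign because n is odd.\<close>
    also have "(\<Sum>k\<le>n. (-1) ^ k * y (n - k) ^ 3) = (\<Sum>k\<le>n. - ((-1) ^ k * y k ^ 3))"
      by (rule sum.reindex_bij_witness[of _ "\<lambda>k. n - k" "\<lambda>k. n - k"])
        (use assms(1) in \<open>auto simp: minus_one_power_iff\<close>)
    also have "\<dots> + 2 * c ^ 3 * (\<Sum>k\<le>n. (-1) ^ k * b k ^ 3) = - (\<Sum>k\<le>n. (-1) ^ k * y k ^ 3)"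
      unfolding b0 by (simp add: sum_negf)
    also have "rat_cong p 2 (- (\<Sum>k\<le>n. (-1) ^ k * y k ^ 3)) (- 0)"
      by (rule rat_cong_minus[OF y0])
    finally show "rat_cong p 2 (3 * c ^ 3 * (\<Sum>k\<le>n. (-1) ^ k * (w k * b k ^ 3))) (3 * c ^ 3 * 0)"
      by (simp add: sum_distrib_left mult_ac)
    have "\<not> p dvd ((n + p) choose n)"
    proof
      assume "p dvd ((n + p) choose n)"
      then have "rat_cong p 1 c 0" unfolding c_def by (intro rat_cong_of_nat_dvd) simp
      moreover have "rat_cong p 1 c 1"
        using choose_add_p_cong[OF p pn, of n] pn by (simp add: c_def add.commute)
      ultimately have "rat_cong p 1 1 0" using rat_cong_sym rat_cong_trans by blast
      then obtain x where x: "p_integral p x" "1 = of_nat p * x" unfolding rat_cong_iff by auto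
      then obtain a b where ab: "coprime b (int p)" "b \<noteq> 0" "x = of_int a / of_int b"
        unfolding p_integral_iff by blast
      with x have "(of_int b :: rat) = of_int (int p * a)" by (simp add: field_simps)
      then have "b = int p * a" by (simp only: of_int_eq_iff)
      then have "coprime (int p * a) (int p)" using ab(1) by simp
      then have "is_unit (int p)" by (metis coprime_common_divisor dvd_refl dvd_triv_left)
      then show False using pn n_pos[OF p pn] by simp
    qed
    then have "coprime ((n + p) choose n) p" using p prime_imp_coprime coprime_commute by blast
    then have "p_integral p (1 / c)" unfolding c_def by (intro p_integral_inverse_of_nat) auto
    then show "p_integral p (1 / (3 * c ^ 3))"
      using assms(2) by (intro p_integral_inverse_mult[OF p pn] p_integral_inverse_power[OF p pn] p_integral_inverse_3)
  qed (simp add: c_def)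
  have "rat_cong p 2 (\<Sum>k=0..p-1. of_nat ((p - 1) choose k) * (of_nat ((2 * k) choose k) ^ 3 / (-64) ^ k))
      (\<Sum>k\<le>n. (-1) ^ k * (w k * h k ^ 3))"
  proof (rule sum_cong_split_0[OF p pn])
    fix k assume "n < k" "k < p"
    then have "p ^ 3 dvd ((2 * k) choose k) ^ 3"
      by (intro dvd_power_same p_dvd_central_choose[OF p pn])
    then have "p ^ 2 dvd ((2 * k) choose k) ^ 3"
      using power_le_dvd[of p 3 _ 2] by simp
    then have "rat_cong p 2 (of_nat (((2 * k) choose k) ^ 3)) 0"
      by (rule rat_cong_of_nat_dvd)
    then have "rat_cong p 2 (of_nat (((2 * k) choose k) ^ 3) * (of_nat ((p - 1) choose k) * ((-1) ^ k * (1 / 64 ^ k)))) 0"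
      by (rule rat_cong_zero_scale) (simp_all add: p_integral_inverse_16_32_64[OF p pn] p_integral_divide_power_64[OF p pn])
    then show "rat_cong p 2 (of_nat ((p - 1) choose k) * (of_nat ((2 * k) choose k) ^ 3 / (-64) ^ k)) 0"
      by (cases "even k") (simp_all add: power_minus[of 64] mult_ac)
  next
    fix k assume "k \<le> n"
    show "rat_cong p 2 (of_nat ((p - 1) choose k) * (of_nat ((2 * k) choose k) ^ 3 / (-64) ^ k)) ((-1) ^ k * (w k * h k ^ 3))"
    proof -
      have "of_nat ((2 * k) choose k) ^ 3 / (-64) ^ k = h k ^ 3"
        by (simp add: h_def half_choose_def power_divide power3_eq_cube flip: power_mult_distrib)
      then show ?thesis by (cases "even k") (simp_all add: w_def)
    qed
  qed
  \<comment> \<open>Here w = 1 and h^3 = b^3 modulo p, so \<open>mult_cong_perturb\<close> decouples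
    the two deviations; the resulting sums are those of \<open>h0\<close>, \<open>wb0\<close> and
    \<open>b0\<close>.\<close>
  also have "rat_cong p 2 (\<Sum>k\<le>n. (-1) ^ k * (w k * h k ^ 3)) (\<Sum>k\<le>n. (-1) ^ k * (h k ^ 3 + (w k * b k ^ 3 - b k ^ 3)))"
  proof (intro rat_cong_sum rat_cong_scale)
    fix k assume "k \<in> {..n}"
    then have "rat_cong p 1 (h k ^ 3) (b k ^ 3)"
      unfolding h_def b_def by (intro rat_cong_power rat_cong_sym[OF half_choose_cong[OF p pn]]) auto
    with w[of k] have "rat_cong p 2 (w k * h k ^ 3 + 1 * b k ^ 3) (w k * b k ^ 3 + 1 * h k ^ 3)"
      using \<open>k \<in> {..n}\<close> by (intro mult_cong_perturb) auto
    from rat_cong_diff[OF this rat_cong_refl[of p 2 "b k ^ 3"]]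
    show "rat_cong p 2 (w k * h k ^ 3) (h k ^ 3 + (w k * b k ^ 3 - b k ^ 3))"
      by (simp add: algebra_simps)
  qed simp
  also have "(\<Sum>k\<le>n. (-1) ^ k * (h k ^ 3 + (w k * b k ^ 3 - b k ^ 3)))
      = (\<Sum>k\<le>n. (-1) ^ k * h k ^ 3) + ((\<Sum>k\<le>n. (-1) ^ k * (w k * b k ^ 3)) - (\<Sum>k\<le>n. (-1) ^ k * b k ^ 3))"
    by (simp add: sum.distrib sum_subtractf distrib_left right_diff_distrib)
  also have "rat_cong p 2 \<dots> (0 + (0 - 0))"
    unfolding b0 by (intro rat_cong_add rat_cong_diff h0 wb0 rat_cong_refl)
  finally show ?thesis by simp
qed

end

section \<open>Evaluation for p congruent to 3 modulo 4\<close>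

text \<open>Wilson's theorem is the case k = 0. Trading the factor p - 1 - k of one factorial for k
  + 1 in the other changes the sign modulo p.\<close>

lemma fact_mult_fact_cong:
  assumes "prime p" "k < p"
  shows "[fact k * fact (p - 1 - k) = (-1) ^ (k + 1)] (mod int p)"
  using assms(2)
proof (induction k)
  case 0
  then show ?case using wilson_theorem[OF assms(1)] by simp
next
  case (Suc k)
  then have IH: "[fact k * fact (p - 1 - k) = (-1) ^ (k + 1)] (mod int p)" by simp
  have e: "p - 1 - k = Suc (p - 1 - Suc k)" using Suc.prems by simp
  have q: "int (p - 1 - k) = int p - int (Suc k)" using Suc.prems by simp
  have "(fact k * fact (p - 1 - k) :: int) = int (p - 1 - k) * (fact k * fact (p - 1 - Suc k))"
    by (subst e, subst fact_Suc) (simp only: e[symmetric] mult_ac of_nat_id)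
  then have "(fact k * fact (p - 1 - k) :: int) = int p * (fact k * fact (p - 1 - Suc k)) - fact (Suc k) * fact (p - 1 - Suc k)"
    unfolding q fact_Suc by (simp add: algebra_simps)
  with IH have "[int p * (fact k * fact (p - 1 - Suc k)) - fact (Suc k) * fact (p - 1 - Suc k) = (-1) ^ (k + 1)] (mod int p)"
    by simp
  moreover have "[int p * (fact k * fact (p - 1 - Suc k)) - fact (Suc k) * fact (p - 1 - Suc k)
      = - (fact (Suc k) * fact (p - 1 - Suc k))] (mod int p)"
    by (simp add: cong_iff_dvd_diff del: fact_Suc)
  ultimately have "[- (fact (Suc k) * fact (p - 1 - Suc k)) = (-1) ^ (k + 1)] (mod int p)"
    using cong_sym cong_trans by blast
  then have "[- 1 * - (fact (Suc k) * fact (p - 1 - Suc k)) = - 1 * (-1) ^ (k + 1)] (mod int p)"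
    by (rule cong_scalar_left)
  then show ?case by (simp del: fact_Suc)
qed

context
  fixes p m :: nat
  assumes p: "prime p" and pm: "p = 4 * m + 3"
begin

lemma fact_3m_cong: "[fact (3 * m) * fact (m + 2) = (-1) ^ (m + 1)] (mod int p)"
  using fact_mult_fact_cong[OF p, of "m + 2"] pm by (simp add: mult.commute)

text \<open>The prime 5 enters because 4 (m + 2) = p + 5 has to be inverted; p = 3 modulo 4 excludes
  p = 5.\<close>

lemma coprime_power_2_5: "coprime (int p) (2 ^ i)" "coprime (int p) 5"
proof -
  have "coprime p 2" using p pm by (intro primes_coprime) auto
  then have "coprime (int p) 2" by (metis coprime_int_iff of_nat_numeral)
  then show "coprime (int p) (2 ^ i)" by simp
  have "p \<noteq> 5" using pm by presburger
  then have "coprime p 5" using p by (intro primes_coprime) auto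
  then show "coprime (int p) 5" by (metis coprime_int_iff of_nat_numeral)
qed

text \<open>Multiplication by m + 2 completes (3m)! (m+2)!, which \<open>fact_3m_cong\<close>
  evaluates, with cofactor (m+1)^3. At m = -3/4 this gives -(1/4)^3 / (5/4) = -1/80.\<close>

lemma dixon_m_cong:
  "[80 * (fact (m + 1) ^ 4 * ((-1) ^ m * int (((3 * m) choose m) * ((2 * m) choose m)))) = - 1] (mod int p)"
proof -
  define B X f M :: int where "B = int (((3 * m) choose m) * ((2 * m) choose m))"
    and "X = fact (m + 1) ^ 4 * ((-1) ^ m * B)" and "f = fact m" and "M = int m"
  have B: "B * f ^ 3 = fact (3 * m)"
    using arg_cong[OF choose_choose_mult_fact[of m], of int] by (simp add: B_def f_def)
  have facts: "fact (m + 1) = (M + 1) * f" "fact (m + 2) = (M + 2) * ((M + 1) * f)"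
    by (simp_all add: f_def M_def algebra_simps)
  have "(M + 2) * X = (-1) ^ m * (M + 1) ^ 3 * (fact (3 * m) * fact (m + 2))"
    unfolding X_def facts B[symmetric] by (simp add: power_def algebra_simps eval_nat_numeral)
  moreover obtain t where "fact (3 * m) * fact (m + 2) = (-1) ^ (m + 1) + int p * t"
    using fact_3m_cong by (metis cong_iff_lin cong_sym)
  moreover have "e * U * (- e + q * t) = - U + q * (e * U * t)" if "e * e = 1" for e U q :: int
  proof -
    have "e * U * (- e + q * t) = - (e * e) * U + q * (e * U * t)" by (simp add: algebra_simps)
    then show ?thesis by (simp add: that)
  qed
  moreover have "(-1) ^ m * (-1) ^ m = (1 :: int)" "(-1) ^ (m + 1) = - ((-1) ^ m :: int)"
    by (simp_all flip: power_mult_distrib)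
  ultimately have t: "(M + 2) * X = - ((M + 1) ^ 3) + int p * ((-1) ^ m * (M + 1) ^ 3 * t)"
    by metis
  have M: "4 * M = int p - 3" using pm by (simp add: M_def)
  \<comment> \<open>Scaling by 256 lets m occur only through 4m = p - 3.\<close>
  have "64 * (4 * M + 8) * X = - 4 * (4 * M + 4) ^ 3 + int p * (256 * ((-1) ^ m * (M + 1) ^ 3 * t))"
    using arg_cong[OF t, of "\<lambda>x. 256 * x"] by (simp add: algebra_simps power3_eq_cube)
  then have "4 * (80 * X + 1) = int p * (256 * ((-1) ^ m * (M + 1) ^ 3 * t) - 64 * X - 4 * (int p ^ 2 + 3 * int p + 3))"
    unfolding M by (simp add: algebra_simps power3_eq_cube power2_eq_square)
  then have "int p dvd 4 * (80 * X + 1)" by (rule dvdI)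
  moreover have "coprime (int p) 4" using coprime_power_2_5(1)[of 2] by simp
  ultimately have "int p dvd 80 * X + 1" by (metis coprime_dvd_mult_right_iff)
  then show ?thesis unfolding X_def B_def by (simp add: cong_iff_dvd_diff)
qed

text \<open>The additional factors (3m+3) (3m+2) (3m+1) are (3/4) (-1/4) (-5/4) modulo p; division
  by m + 2 = 5/4 yields 3/16.\<close>

lemma dixon_Suc_m_cong:
  "[16 * (fact (m + 1) ^ 4 * ((-1) ^ (m + 1) * int (((3 * (m + 1)) choose (m + 1)) * ((2 * (m + 1)) choose (m + 1))))) = 3] (mod int p)"
proof -
  define B X f M :: int where "B = int (((3 * (m + 1)) choose (m + 1)) * ((2 * (m + 1)) choose (m + 1)))"
    and "X = fact (m + 1) ^ 4 * ((-1) ^ (m + 1) * B)" and "f = fact (m + 1)" and "M = int m"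
  have B: "B * f ^ 3 = fact (3 * (m + 1))"
    using arg_cong[OF choose_choose_mult_fact[of "m + 1"], of int]
    by (simp only: of_nat_mult of_nat_power of_nat_fact B_def f_def)
  have "3 * (m + 1) = Suc (Suc (Suc (3 * m)))" by simp
  then have "(fact (3 * (m + 1)) :: int) = int (Suc (Suc (Suc (3 * m)))) * (int (Suc (Suc (3 * m))) * (int (Suc (3 * m)) * fact (3 * m)))"
    by (simp only: fact_Suc)
  then have f3: "fact (3 * (m + 1)) = (3 * M + 3) * (3 * M + 2) * (3 * M + 1) * fact (3 * m)"
    by (simp add: M_def mult.assoc add.commute)
  have f2: "fact (m + 2) = (M + 2) * f"
    by (simp add: f_def M_def algebra_simps)
  have "(M + 2) * X = (-1) ^ (m + 1) * ((B * f ^ 3) * fact (m + 2))"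
    unfolding X_def f2 f_def[symmetric] by (simp add: algebra_simps eval_nat_numeral)
  then have "(M + 2) * X = (-1) ^ (m + 1) * ((3 * M + 3) * (3 * M + 2) * (3 * M + 1)) * (fact (3 * m) * fact (m + 2))"
    unfolding B f3 by (simp only: mult_ac)
  moreover obtain t where "fact (3 * m) * fact (m + 2) = (-1) ^ (m + 1) + int p * t"
    using fact_3m_cong by (metis cong_iff_lin cong_sym)
  moreover have "e * U * (e + q * t) = U + q * (e * U * t)" if "e * e = 1" for e U q :: int
  proof -
    have "e * U * (e + q * t) = (e * e) * U + q * (e * U * t)" by (simp add: algebra_simps)
    then show ?thesis by (simp add: that)
  qed
  moreover have "(-1) ^ (m + 1) * (-1) ^ (m + 1) = (1 :: int)"
    by (simp flip: power_mult_distrib)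
  ultimately have t: "(M + 2) * X = (3 * M + 3) * (3 * M + 2) * (3 * M + 1) + int p * ((-1) ^ (m + 1) * ((3 * M + 3) * (3 * M + 2) * (3 * M + 1)) * t)"
    (is "_ = _ + int p * ?T") by metis
  have M: "4 * M = int p - 3" using pm by (simp add: M_def)
  have "64 * (4 * M + 8) * X = 4 * ((3 * (4 * M) + 12) * (3 * (4 * M) + 8) * (3 * (4 * M) + 4)) + int p * (256 * ?T)"
    using arg_cong[OF t, of "\<lambda>x. 256 * x"] by (simp add: algebra_simps)
  then have "20 * (16 * X - 3) = int p * (256 * ?T - 64 * X + 4 * (27 * int p ^ 2 - 27 * int p - 39))"
    unfolding M by (simp add: algebra_simps power2_eq_square)
  then have "int p dvd 20 * (16 * X - 3)" by (rule dvdI)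
  moreover have "coprime (int p) (2 ^ 2 * 5)" using coprime_power_2_5 by (simp only: coprime_mult_right_iff)
  then have "coprime (int p) 20" by simp
  ultimately have "int p dvd 16 * X - 3" by (metis coprime_dvd_mult_right_iff)
  then show ?thesis unfolding X_def B_def by (simp add: cong_iff_dvd_diff)
qed

end

lemma fact_powi_minus_4: "(fact k :: rat) powi (-4) = 1 / fact k ^ 4"
  by (simp add: power_int_def divide_inverse power_inverse)

context
  fixes p m :: nat
  assumes p: "prime p" and pm: "p = 4 * m + 3"
begin

lemma p_eq_odd: "p = 2 * (2 * m + 1) + 1"
  using pm by simp

lemma p_integral_inverse_fact: "p_integral p (1 / fact (m + 1) ^ 4)"
proof -
  have "\<not> p dvd fact (m + 1)" unfolding prime_dvd_fact_iff[OF p] using pm by simp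
  then have "coprime (fact (m + 1)) p" using p prime_imp_coprime coprime_commute by blast
  from p_integral_inverse_of_nat[OF this]
  have "p_integral p (1 / fact (m + 1))" by (simp only: of_nat_fact fact_nonzero) simp
  then show ?thesis by (rule p_integral_inverse_power[OF p p_eq_odd])
qed

lemma sum_cube_cong_3:
  "rat_cong p 1 (\<Sum>k=0..p-1. of_nat k ^ 3 * of_nat ((2 * k) choose k) ^ 3 / 64 ^ k)
     (- (1 / 640) * fact (m + 1) powi (-4))"
proof (rule rat_cong_trans[OF sum_cube_cong[OF p p_eq_odd]], rule rat_cong_cancel)
  define B :: int where "B = (-1) ^ m * int (((3 * m) choose m) * ((2 * m) choose m))"
  define F n :: rat where "F = fact (m + 1)" and "n = of_nat (2 * m + 1)"
  have F: "F \<noteq> 0" unfolding F_def by (rule fact_nonzero)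
  have D: "(\<Sum>j\<le>2 * m + 1 - 1. (-1) ^ j * of_nat ((2 * m + 1 - 1) choose j) ^ 3) = (of_int B :: rat)"
    unfolding add_diff_cancel_right' dixon_even B_def by simp
  have "rat_cong p 1 (2 * n) (-1)"
    by (rule rat_congI[of p 1]) (simp_all add: n_def pm)
  then have "rat_cong p 1 ((2 * n) ^ 3) ((-1) ^ 3)" by (rule rat_cong_power) simp
  moreover have "rat_cong p 1 (80 * (F ^ 4 * of_int B)) (-1)"
  proof -
    have "rat_cong p 1 (of_int (80 * (fact (m + 1) ^ 4 * B))) (of_int (-1))"
      using dixon_m_cong[OF p pm] unfolding B_def[symmetric] by (intro rat_cong_of_int) simp
    then show ?thesis by (simp only: F_def of_int_mult of_int_power of_int_fact of_int_numeral of_int_minus of_int_1)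
  qed
  ultimately have "rat_cong p 1 ((2 * n) ^ 3 * (80 * (F ^ 4 * of_int B))) ((-1) ^ 3 * (-1))"
    by (rule rat_cong_mult) (simp_all add: F_def del: fact_Suc)
  then have "rat_cong p 1 (- ((2 * n) ^ 3 * (80 * (F ^ 4 * of_int B)))) (- ((-1) ^ 3 * (-1)))"
    by (rule rat_cong_minus)
  moreover have "- ((2 * n) ^ 3 * (80 * (F ^ 4 * of_int B))) = 640 * F ^ 4 * (- (n ^ 3) * of_int B)"
    by (simp add: power_mult_distrib)
  moreover have "- ((-1) ^ 3 * (-1)) = 640 * F ^ 4 * (- (1 / 640) * fact (m + 1) powi (-4))"
    unfolding F_def fact_powi_minus_4 using F[unfolded F_def] by (simp del: fact_Suc)
  ultimately show "rat_cong p 1 (640 * F ^ 4 * (- (of_nat (2 * m + 1) ^ 3) * (\<Sum>j\<le>2 * m + 1 - 1. (-1) ^ j * of_nat ((2 * m + 1 - 1) choose j) ^ 3)))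
      (640 * F ^ 4 * (- (1 / 640) * fact (m + 1) powi (-4)))"
    unfolding D n_def[symmetric] by (simp only:)
  have "coprime (int p) (2 ^ 7 * 5)" using coprime_power_2_5[OF p pm] by (simp only: coprime_mult_right_iff)
  then have "p_integral p (1 / of_int 640)"
    by (intro p_integral_inverse_of_int) (simp_all add: coprime_commute)
  then show "p_integral p (1 / (640 * F ^ 4))"
    using p_integral_inverse_fact unfolding F_def by (intro p_integral_inverse_mult[OF p p_eq_odd]) simp_all
  show "640 * F ^ 4 \<noteq> 0" using F by simp
qed

lemma catalan_cube_cong_3:
  "rat_cong p 1 (\<Sum>k=0..p-1. catalan k ^ 3 / 64 ^ k) (7 - 3 / 2 * fact (m + 1) powi (-4))"
proof (rule rat_cong_trans[OF catalan_cube_sum_cong[OF p p_eq_odd]], rule rat_cong_diff[OF rat_cong_refl], rule rat_cong_cancel)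
  define B :: int where "B = (-1) ^ (m + 1) * int (((3 * (m + 1)) choose (m + 1)) * ((2 * (m + 1)) choose (m + 1)))"
  define F :: rat where "F = fact (m + 1)"
  have F: "F \<noteq> 0" unfolding F_def by (rule fact_nonzero)
  have "2 * m + 1 + 1 = 2 * (m + 1)" by simp
  then have D: "(\<Sum>j\<le>2 * m + 1 + 1. (-1) ^ j * of_nat ((2 * m + 1 + 1) choose j) ^ 3) = (of_int B :: rat)"
    by (simp only: dixon_even B_def of_int_mult of_int_power of_int_minus of_int_1 of_int_of_nat_eq)
  have "rat_cong p 1 (16 * (F ^ 4 * of_int B)) 3"
  proof -
    have "rat_cong p 1 (of_int (16 * (fact (m + 1) ^ 4 * B))) (of_int 3)"
      using dixon_Suc_m_cong[OF p pm] unfolding B_def[symmetric] by (intro rat_cong_of_int) (simp only: power_one_right)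
    then show ?thesis by (simp only: F_def of_int_mult of_int_power of_int_fact of_int_numeral)
  qed
  moreover have "16 * (F ^ 4 * of_int B) = 2 * F ^ 4 * (8 * of_int B)" by simp
  moreover have "3 = 2 * F ^ 4 * (3 / 2 * fact (m + 1) powi (-4))"
    unfolding F_def fact_powi_minus_4 using F[unfolded F_def] by (simp del: fact_Suc)
  ultimately show "rat_cong p 1 (2 * F ^ 4 * (8 * (\<Sum>j\<le>2 * m + 1 + 1. (-1) ^ j * of_nat ((2 * m + 1 + 1) choose j) ^ 3)))
      (2 * F ^ 4 * (3 / 2 * fact (m + 1) powi (-4)))"
    unfolding D by (simp only:)
  show "p_integral p (1 / (2 * F ^ 4))"
    using p_integral_inverse_fact unfolding F_def
    by (intro p_integral_inverse_mult[OF p p_eq_odd] p_integral_inverse_2[OF p p_eq_odd])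
  show "2 * F ^ 4 \<noteq> 0" using F by simp
qed

section \<open>Powers of 2 and the Legendre value modulo p^2\<close>

text \<open>
  The quadratic character of 2 comes from comparing \<open>half_choose m\<close> with \<open>(2 * m + 1) choose m\<close>:
  their quotient is \<open>(-4) ^ m * (2 * m + 1) / (m + 1)\<close>, which is \<open>-2 * (-4) ^ m\<close> modulo \<open>p\<close>.
\<close>

lemma two_power_cong: "rat_cong p 1 (2 ^ (2 * m + 1)) ((-1) ^ (m + 1))"
proof -
  define C b M :: rat where "C = of_nat ((2 * m) choose m)" and "b = of_nat ((2 * m + 1) choose m)" and "M = of_nat m + 1"
  have M: "4 * M = of_nat p + 1" by (simp add: M_def pm)
  have "Suc m * ((2 * m + 1) choose m) = (2 * m + 1) * ((2 * m) choose m)"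
    using Suc_times_binomial[of m "2 * m"] binomial_symmetric[of m "2 * m + 1"] by (simp add: mult_2)
  then have "of_nat (Suc m) * b = of_nat (2 * m + 1) * C"
    unfolding b_def C_def by (metis of_nat_mult)
  then have b: "4 * M * b = (8 * M - 4) * C" by (simp add: M_def algebra_simps)
  have "\<not> p dvd fact (2 * m)" unfolding prime_dvd_fact_iff[OF p] using pm by simp
  moreover have "((2 * m) choose m) dvd fact (2 * m)"
    using binomial_fact_lemma[of m "2 * m"] by (metis dvd_triv_right le_add1 mult_2)
  ultimately have "\<not> p dvd ((2 * m) choose m)" by (metis dvd_trans)
  then have "coprime ((2 * m) choose m) p" using p prime_imp_coprime coprime_commute by blast
  then have C: "p_integral p (1 / C)" "C \<noteq> 0"
    unfolding C_def by (auto intro: p_integral_inverse_of_nat)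
  have "rat_cong p 1 b (half_choose m)"
    unfolding b_def by (rule half_choose_cong[OF p p_eq_odd]) simp
  then have "rat_cong p 1 (4 * M * b) (4 * M * half_choose m)"
    by (rule rat_cong_scale) (simp add: M)
  then have "rat_cong p 1 ((-4) ^ m * (4 * M * b)) ((-4) ^ m * (4 * M * half_choose m))"
    by (rule rat_cong_scale) simp
  moreover have "(-4) ^ m * (4 * M * half_choose m) = C * (of_nat p + 1)"
    unfolding M half_choose_def C_def by simp
  moreover have "(-4) ^ m * (4 * M * b) = C * ((-4) ^ m * (2 * of_nat p - 2))"
  proof -
    have "8 * M - 4 = 2 * of_nat p - 2" using M by simp
    then show ?thesis unfolding b by (simp only: mult_ac)
  qed
  ultimately have "rat_cong p 1 (C * ((-4) ^ m * (2 * of_nat p - 2))) (C * (of_nat p + 1))" by simp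
  then have "rat_cong p 1 ((-4) ^ m * (2 * of_nat p - 2)) (of_nat p + 1)"
    using C by (rule rat_cong_cancel)
  moreover have "rat_cong p 1 (of_nat p + 1) 1"
    by (rule rat_congI[of p 1]) simp_all
  moreover have "rat_cong p 1 ((-4) ^ m * (- 2)) ((-4) ^ m * (2 * of_nat p - 2))"
    by (rule rat_congI[of p "- 2 * (-4) ^ m"]) (simp_all add: algebra_simps)
  ultimately have "rat_cong p 1 ((-4) ^ m * (- 2)) 1"
    by (blast intro: rat_cong_trans)
  then have "rat_cong p 1 ((-1) ^ (m + 1) * ((-4) ^ m * (- 2))) ((-1) ^ (m + 1) * 1)"
    by (rule rat_cong_scale) simp
  moreover have "(-1) ^ (m + 1) * ((-4) ^ m * (- 2)) = (2 ^ (2 * m + 1) :: rat)"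
    by (simp add: power_mult power_minus[of 4])
  ultimately show ?thesis by (simp only: mult_1_right)
qed

text \<open>Put T = 2^(2m+1) and e = (-1)^(m+1). The integral is -4 e / ((p + 1) T) times the
  binomial. As T = e modulo p, -4 e / T is 2 T^2 - 6 = 2^p - 6 modulo p^2, and 1 / (p + 1) = 1 - p
  contributes the summand 4p.\<close>

lemma legendre_integral_cong_3:
  "rat_cong p 2 (legendre_integral (2 * m + 1)) ((4 * of_nat p + 2 ^ p - 6) * of_nat ((2 * m) choose m))"
proof (rule rat_cong_cancel)
  define C T e P :: rat where "C = of_nat ((2 * m) choose m)" and "T = 2 ^ (2 * m + 1)" and "e = (-1) ^ (m + 1)" and "P = of_nat p"
  obtain t where t: "p_integral p t" "T = e + P * t"
    using two_power_cong unfolding rat_cong_iff T_def e_def P_def by (auto simp: algebra_simps)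
  have "2 * (2 * m + 1) + 1 = p" using pm by simp
  then have T2: "2 ^ p = 2 * T ^ 2" unfolding T_def power_mult[symmetric] by (metis power_Suc mult.commute Suc_eq_plus1)
  have e: "e = 1 \<or> e = -1" unfolding e_def by (metis minus_one_power_iff)
  have M: "2 * of_nat (m + 1) = (P + 1) / 2" by (simp add: P_def pm)
  have T4: "4 ^ m = T / 2" by (simp add: T_def power_mult)
  have T0: "T \<noteq> 0" by (simp add: T_def)
  have P0: "P + 1 \<noteq> 0" unfolding P_def by (metis of_nat_Suc of_nat_eq_0_iff add.commute nat.distinct(1))
  have "legendre_integral (2 * m + 1) = - e * C / ((P + 1) / 2 * (T / 2))"
    unfolding legendre_integral_odd M T4 by (simp add: e_def C_def)
  moreover have "q * T * (- e * C / (q / 2 * (T / 2))) = - 4 * e * C" if "q \<noteq> 0" for q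
    using T0 that by (simp add: field_simps)
  ultimately have L: "(P + 1) * T * legendre_integral (2 * m + 1) = - 4 * e * C"
    using P0 by (simp only:) simp
  have "rat_cong p 2 (C * (- 4 * e)) (C * ((P + 1) * T * (4 * P + 2 * T ^ 2 - 6)))"
  proof (rule rat_cong_scale, rule rat_congI)
    \<comment> \<open>\<open>?W\<close> is 4 P + 2 T^2 - 6 with T = e + P t and e^2 = 1 inserted;
      the witness collects the terms of (P + 1) T times \<open>?W\<close> that contain P^2.\<close>
    let ?W = "4 * P - 4 + 4 * e * P * t + 2 * P ^ 2 * t ^ 2"
    show "p_integral p (- (2 * e * t ^ 2 + (e + t) * (4 + 4 * e * t + 2 * P * t ^ 2) + t * ?W))"
      unfolding p_integral_minus using t by (intro p_integral_add p_integral_mult p_integral_diff p_integral_power) (simp_all add: e_def P_def)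
    show "- 4 * e - (P + 1) * T * (4 * P + 2 * T ^ 2 - 6) = of_nat p ^ 2 * - (2 * e * t ^ 2 + (e + t) * (4 + 4 * e * t + 2 * P * t ^ 2) + t * ?W)"
      unfolding P_def[symmetric] t(2) using e by (elim disjE) (simp_all add: power2_eq_square algebra_simps)
  qed (simp add: C_def)
  then show "rat_cong p 2 ((P + 1) * T * legendre_integral (2 * m + 1)) ((P + 1) * T * ((4 * of_nat p + 2 ^ p - 6) * of_nat ((2 * m) choose m)))"
    unfolding L T2 C_def[symmetric] P_def[symmetric] by (simp only: mult_ac)
  have "p_integral p (1 / of_nat (p + 1))"
    by (rule p_integral_inverse_of_nat) simp_all
  then show "p_integral p (1 / ((P + 1) * T))"
    unfolding P_def T_def
    by (intro p_integral_inverse_mult[OF p p_eq_odd] p_integral_inverse_power_2[OF p p_eq_odd]) (simp add: add.commute)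
  show "(P + 1) * T \<noteq> 0" using T0 P0 by simp
qed

end

theorem theorem1p2:
  fixes p :: nat
  assumes "prime p" and "odd p"
  shows
    "((p mod 4 = 1 \<longrightarrow>
         rat_cong p 1 (\<Sum>k=0..p-1. of_nat k ^ 3 * of_nat ((2 * k) choose k) ^ 3 / 64 ^ k) 0) \<and>
      (p mod 4 = 3 \<longrightarrow>
         rat_cong p 1 (\<Sum>k=0..p-1. of_nat k ^ 3 * of_nat ((2 * k) choose k) ^ 3 / 64 ^ k)
           (- (1 / 640) * fact ((p + 1) div 4) powi (-4))) \<and>
      (p > 3 \<and> p mod 4 = 3 \<longrightarrow>
         rat_cong p 2
           (\<Sum>k=0..p-1. of_nat ((p - 1) choose k) * (of_nat ((2 * k) choose k) ^ 3 / (-64) ^ k)) 0))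
     \<and>
     (rat_cong p 1 (\<Sum>k=0..p-1. catalan k ^ 2 / 16 ^ k) (-3) \<and>
      (p mod 4 = 1 \<longrightarrow>
         rat_cong p 1 (\<Sum>k=0..p-1. catalan k ^ 3 / 64 ^ k) 7) \<and>
      (p mod 4 = 3 \<longrightarrow>
         rat_cong p 1 (\<Sum>k=0..p-1. catalan k ^ 3 / 64 ^ k)
           (7 - 3 / 2 * fact ((p + 1) div 4) powi (-4))) \<and>
      (p mod 4 = 1 \<longrightarrow>
         rat_cong p 2 (\<Sum>k=0..p-1. of_nat ((2 * k) choose k) * catalan k / 32 ^ k) (of_nat p)) \<and>
      (p mod 4 = 3 \<longrightarrow>
         rat_cong p 2 (\<Sum>k=0..p-1. of_nat ((2 * k) choose k) * catalan k / 32 ^ k)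
           (of_nat p + (4 * of_nat p + 2 ^ p - 6) * of_nat (((p - 3) div 2) choose ((p - 3) div 4)))))"
proof -
  obtain n where n: "p = 2 * n + 1" using \<open>odd p\<close> by (rule oddE)
  note pn = \<open>prime p\<close> n
  have n_pos: "n > 0" using n_pos[OF pn] by simp
  \<comment> \<open>For even n both Dixon exponents n - 1 and n + 1 are odd, and the Legendre
    integral of index n > 0 vanishes.\<close>
  have even_n: "even n" if "p mod 4 = 1" using that n by presburger
  have 1: "rat_cong p 1 (\<Sum>k=0..p-1. of_nat k ^ 3 * of_nat ((2 * k) choose k) ^ 3 / 64 ^ k) 0"
    if "p mod 4 = 1"
  proof -
    have "odd (n - 1)" using even_n[OF that] n_pos by simp
    from dixon_odd[OF this, where 'a = rat] show ?thesis
      using sum_cube_cong[OF pn] by (simp only: mult_zero_right)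
  qed
  have 5: "rat_cong p 1 (\<Sum>k=0..p-1. catalan k ^ 3 / 64 ^ k) 7" if "p mod 4 = 1"
  proof -
    have "odd (n + 1)" using even_n[OF that] by simp
    from dixon_odd[OF this, where 'a = rat] show ?thesis
      using catalan_cube_sum_cong[OF pn] by (simp only: mult_zero_right diff_zero)
  qed
  have 7: "rat_cong p 2 (\<Sum>k=0..p-1. of_nat ((2 * k) choose k) * catalan k / 32 ^ k) (of_nat p)" if "p mod 4 = 1"
    using central_catalan_sum_cong[OF pn] legendre_integral_even[OF even_n[OF that] n_pos] by simp
  have 3: "rat_cong p 1 (\<Sum>k=0..p-1. of_nat k ^ 3 * of_nat ((2 * k) choose k) ^ 3 / 64 ^ k)
      (- (1 / 640) * fact ((p + 1) div 4) powi (-4))"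
    "rat_cong p 1 (\<Sum>k=0..p-1. catalan k ^ 3 / 64 ^ k) (7 - 3 / 2 * fact ((p + 1) div 4) powi (-4))"
    "rat_cong p 2 (\<Sum>k=0..p-1. of_nat ((2 * k) choose k) * catalan k / 32 ^ k)
       (of_nat p + (4 * of_nat p + 2 ^ p - 6) * of_nat (((p - 3) div 2) choose ((p - 3) div 4)))"
    if "p mod 4 = 3"
  proof -
    define m where "m = p div 4"
    have m: "p = 4 * m + 3" using that div_mult_mod_eq[of p 4] by (simp add: m_def)
    have div: "(p + 1) div 4 = m + 1" "(p - 3) div 2 = 2 * m" "(p - 3) div 4 = m" "n = 2 * m + 1"
      using m n by simp_all
    show "rat_cong p 1 (\<Sum>k=0..p-1. of_nat k ^ 3 * of_nat ((2 * k) choose k) ^ 3 / 64 ^ k)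
      (- (1 / 640) * fact ((p + 1) div 4) powi (-4))"
      unfolding div by (rule sum_cube_cong_3[OF \<open>prime p\<close> m])
    show "rat_cong p 1 (\<Sum>k=0..p-1. catalan k ^ 3 / 64 ^ k) (7 - 3 / 2 * fact ((p + 1) div 4) powi (-4))"
      unfolding div by (rule catalan_cube_cong_3[OF \<open>prime p\<close> m])
    have "rat_cong p 2 (\<Sum>k=0..p-1. of_nat ((2 * k) choose k) * catalan k / 32 ^ k) (of_nat p + legendre_integral (2 * m + 1))"
      using central_catalan_sum_cong[OF pn] unfolding div by (simp only: add.commute)
    also have "rat_cong p 2 \<dots> (of_nat p + (4 * of_nat p + 2 ^ p - 6) * of_nat ((2 * m) choose m))"
      by (intro rat_cong_add rat_cong_refl legendre_integral_cong_3[OF \<open>prime p\<close> m])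
    finally show "rat_cong p 2 (\<Sum>k=0..p-1. of_nat ((2 * k) choose k) * catalan k / 32 ^ k)
       (of_nat p + (4 * of_nat p + 2 ^ p - 6) * of_nat (((p - 3) div 2) choose ((p - 3) div 4)))"
      unfolding div .
  qed
  have 4: "rat_cong p 2 (\<Sum>k=0..p-1. of_nat ((p - 1) choose k) * (of_nat ((2 * k) choose k) ^ 3 / (-64) ^ k)) 0"
    if "p > 3" "p mod 4 = 3"
  proof -
    have "odd n" using that n by presburger
    then show ?thesis using that by (intro sum_choose_central_cube_cong[OF pn])
  qed
  show ?thesis
    using 1 3 4 5 7 catalan_square_sum_cong[OF pn] by blast
qed

end
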